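(* Let $\tilde\delta_n$ be a sequence of random elements of $\mathbb{R}^p$ and let $q_n$ be a sequence of (almost surely twice continuously differentiable) log likelihoods having parameter space $\mathbb{R}^p$ and true parameter value zero. Suppose $$(q_n,\tilde\delta_n)\stackrel{\mathcal{L}}{\longrightarrow}(q,\tilde\delta)\qquad\text{in } C^2(\mathbb{R}^p)\times\mathbb{R}^p,$$ where $q$ is the log likelihood of an LAMN model, $q(\delta)=\delta'Z-\tfrac12\delta'K\delta$, $\delta\in\mathbb{R}^p$, with true parameter value zero and with $K$ almost surely positive definite. Let $G^\infty$ be the infinite-step Newton map and define $\hat\delta_n = G^\infty(q_n,\tilde\delta_n)$. Then (a) $-\nabla^2 q_n(\tilde\delta_n)\stackrel{\mathcal{L}}{\longrightarrow}K$; (b) $-\nabla^2 q_n(\hat\delta_n)\stackrel{\mathcal{L}}{\longrightarrow}K$; (c) $\hat\delta_n\stackrel{\mathcal{L}}{\longrightarrow}K^{-1}Z$; (d) $\bigl(-\nabla^2 q_n(\hat\delta_n)\bigr)^{1/2}\hat\delta_n\stackrel{\mathcal{L}}{\longrightarrow}\mathcal{N}(0,I)$, where the matrix square root in (d) is the symmetric square root when the matrix is positive definite and NaO otherwise, and $I$ is the $p\times p$ identity matrix. Moreover, the assumed convergence $(q_n,\tilde\delta_n)\stackrel{\mathcal{L}}{\longrightarrow}(q,\tilde\delta)$ and (a), (b), (c), (d) hold jointly; that is, for some random vector $W\sim\mathcal{N}(0,I)$ defined jointly with $(q,\tilde\delta)$, $$\Bigl(q_n,\tilde\delta_n,-\nabla^2q_n(\tilde\delta_n),-\nabla^2q_n(\hat\delta_n),\hat\delta_n,\bigl(-\nabla^2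 q_n(\hat\delta_n)\bigr)^{1/2}\hat\delta_n\Bigr)\stackrel{\mathcal{L}}{\longrightarrow}\bigl(q,\tilde\delta,K,K,K^{-1}Z,W\bigr).$$
   Context: Convergence in law ($\stackrel{\mathcal{L}}{\longrightarrow}$) of random elements $X_n$ of a Polish space $S$ to a random element $X$ means $E f(X_n)\to E f(X)$ for every bounded continuous $f:S\to\mathbb{R}$; products of Polish spaces carry the product topology. $C^2(\mathbb{R}^p)$ is the Polish space of twice continuously differentiable functions $\mathbb{R}^p\to\mathbb{R}$ with the topology of uniform convergence on compact sets of the functions and their first and second partial derivatives. Log likelihoods: for a parametric model with almost surely positive densities $f_\delta$, $\delta\in\mathbb{R}^p$, with respect to a measure, the log likelihood is the random function $\delta\mapsto u(X)+\log f_\delta(X)$, with $X$ the data and $u$ any function not depending on $\delta$. It is regarded as a random element of $C^2(\mathbb{R}^p)$ whose law is that induced by the true parameter value (here zero). The models for different $n$ need have nothing to do with each other except having the same parameter space. LAMN model: a model whose log likelihood is $q(\delta)=\delta'Z-\tfrac12\delta'K\delta$ (up to an additive term not depending on $\delta$), with $Z$ a random $p$-vector and $K$ a random symmetric $p\times p$ matrix, such that the distribution of $K$ does not depend on the parameter $\delta$ and, for parameter value $\delta$, the conditional distribution of $Z$ given $K$ is $\mathcal{N}(K\delta,K)$. In particular, for true parameter value zero, $Z\mid K\sim\mathcal{N}(0,K)$. NaO ("not an object") is a special value added as an isolated point to a Polish space (giving a Polish space again); it propagates through all operations, i.e. any expression with an argument equal to NaO has value NaO. Quantities that may be NaO are random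 elements of the corresponding Euclidean or matrix space with the isolated point NaO added. One-step Newton map: for $q\in C^2(\mathbb{R}^p)$ and $\delta\in\mathbb{R}^p\cup\{\mathrm{NaO}\}$, $$G(q,\delta)=\delta+\bigl(-\nabla^2q(\delta)\bigr)^{-1}\nabla q(\delta)$$ when $\delta\ne\mathrm{NaO}$ and $-\nabla^2q(\delta)$ is positive definite, and $G(q,\delta)=\mathrm{NaO}$ otherwise. Infinite-step Newton map: put $\delta_0=\delta$ and $\delta_m=G(q,\delta_{m-1})$ for $m>0$; if the sequence $\{\delta_m\}$ converges, $G^\infty(q,\delta)=\lim_{m\to\infty}\delta_m$; otherwise $G^\infty(q,\delta)=\mathrm{NaO}$. *)

theory Defs
  imports "HOL-Probability.Probability"
begin

section \<open>Symmetric matrices and the multivariate normal distribution\<close>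

definition pos_def :: "real^'p^'p \<Rightarrow> bool" where
  "pos_def A \<longleftrightarrow> transpose A = A \<and> (\<forall>x. x \<noteq> 0 \<longrightarrow> 0 < x \<bullet> (A *v x))"

definition pos_semidef :: "real^'p^'p \<Rightarrow> bool" where
  "pos_semidef A \<longleftrightarrow> transpose A = A \<and> (\<forall>x. 0 \<le> x \<bullet> (A *v x))"

text \<open>The symmetric square root. It is only meaningful for positive semidefinite \<open>A\<close>, for which
  \<open>R\<close> exists and is unique.\<close>

definition sym_sqrt :: "real^'p^'p \<Rightarrow> real^'p^'p" where
  "sym_sqrt A = (THE R. pos_semidef R \<and> R ** R = A)"

definition std_mvn :: "(real^'p) measure" where
  "std_mvn = density lborel (\<lambda>x. ennreal (\<Prod>i\<in>UNIV. std_normal_density (x $ i)))"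

text \<open>The normal distribution with mean \<open>m\<close> and (positive semidefinite, possibly singular)
  covariance matrix \<open>S\<close>, as the law of \<open>m + S\<^sup>1\<^sup>/\<^sup>2 \<xi>\<close> with \<open>\<xi>\<close> standard normal.\<close>

definition mvn :: "real^'p \<Rightarrow> real^'p^'p \<Rightarrow> (real^'p) measure" where
  "mvn m S = distr std_mvn borel (\<lambda>x. m + sym_sqrt S *v x)"


section \<open>The space of twice continuously differentiable functions\<close>

definition grad :: "(real^'p \<Rightarrow> real) \<Rightarrow> real^'p \<Rightarrow> real^'p" where
  "grad f x = (\<chi> i. frechet_derivative f (at x) (axis i 1))"

definition hess :: "(real^'p \<Rightarrow> real) \<Rightarrow> real^'p \<Rightarrow> real^'p^'p" where
  "hess f x = jacobian (grad f) (at x)"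

definition twice_cont_diff :: "(real^'p \<Rightarrow> real) \<Rightarrow> bool" where
  "twice_cont_diff f \<longleftrightarrow>
     (\<forall>x. f differentiable at x) \<and> (\<forall>x. grad f differentiable at x) \<and> continuous_on UNIV (hess f)"

lemma twice_cont_diff_const: "twice_cont_diff (\<lambda>x::real^'p. 0)"
proof -
  have g: "grad (\<lambda>x::real^'p. 0) = (\<lambda>x. 0)"
    by (auto simp: grad_def vec_eq_iff fun_eq_iff)
  have "frechet_derivative (\<lambda>x::real^'p. 0::real^'p) (at x) = (\<lambda>h. 0)" for x
    by simp
  then have "hess (\<lambda>x::real^'p. 0) = (\<lambda>x. 0)"
    by (simp add: hess_def jacobian_def g matrix_def fun_eq_iff vec_eq_iff)
  then show ?thesis
    by (simp add: twice_cont_diff_def g)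
qed

typedef (overloaded) ('p::finite) c2 = "{f :: real^'p \<Rightarrow> real. twice_cont_diff f}"
  morphisms c2_fun Abs_c2
  using twice_cont_diff_const by blast

definition c2_nbhd :: "('p::finite) c2 \<Rightarrow> (real^'p) set \<Rightarrow> real \<Rightarrow> 'p c2 set" where
  "c2_nbhd f C e = {g. \<forall>x\<in>C. \<bar>c2_fun g x - c2_fun f x\<bar> < e \<and>
     norm (grad (c2_fun g) x - grad (c2_fun f) x) < e \<and>
     norm (hess (c2_fun g) x - hess (c2_fun f) x) < e}"

text \<open>The topology of uniform convergence on compact sets of functions and their first and second
  partial derivatives.\<close>

instantiation c2 :: (finite) topological_space
begin

definition open_c2 :: "'a c2 set \<Rightarrow> bool" where
  "open_c2 U \<longleftrightarrow> (\<forall>f\<in>U. \<exists>C e. compact C \<and> 0 < e \<and> c2_nbhd f C e \<subseteq> U)"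

instance
proof
  show "open (UNIV :: 'a c2 set)"
    unfolding open_c2_def by (auto intro!: exI[of _ "{}"] exI[of _ 1])
next
  fix S T :: "'a c2 set"
  assume S: "open S" and T: "open T"
  show "open (S \<inter> T)"
    unfolding open_c2_def
  proof
    fix f assume f: "f \<in> S \<inter> T"
    obtain C d where 1: "compact C" "0 < d" "c2_nbhd f C d \<subseteq> S"
      using S f unfolding open_c2_def by blast
    obtain D e where 2: "compact D" "0 < e" "c2_nbhd f D e \<subseteq> T"
      using T f unfolding open_c2_def by blast
    have "c2_nbhd f (C \<union> D) (min d e) \<subseteq> c2_nbhd f C d \<inter> c2_nbhd f D e"
      unfolding c2_nbhd_def by auto
    with 1 2 show "\<exists>C e. compact C \<and> 0 < e \<and> c2_nbhd f C e \<subseteq> S \<inter> T"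
      by (intro exI[of _ "C \<union> D"] exI[of _ "min d e"]) (auto simp: compact_Un)
  qed
next
  fix K :: "'a c2 set set"
  assume "\<forall>S\<in>K. open S"
  then show "open (\<Union>K)"
    unfolding open_c2_def by (meson Sup_upper UnionE subset_trans)
qed

end


section \<open>The value NaO\<close>

text \<open>NaO is the \<open>None\<close> of the option type, as an isolated point. Propagation of NaO is
  \<^const>\<open>map_option\<close> and \<^const>\<open>Option.bind\<close>.\<close>

abbreviation NaO :: "'a option" where
  "NaO \<equiv> None"

instantiation option :: (topological_space) topological_space
begin

definition open_option :: "'a option set \<Rightarrow> bool" where
  "open_option U \<longleftrightarrow> open (Some -` U)"

instance
  by standard (auto simp: open_option_def vimage_Union intro: open_Int)

end

instance option :: (t2_space) t2_space
proof
  fix x y :: "'a option"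
  assume "x \<noteq> y"
  show "\<exists>U V. open U \<and> open V \<and> x \<in> U \<and> y \<in> V \<and> U \<inter> V = {}"
  proof (cases x)
    case None
    then show ?thesis using \<open>x \<noteq> y\<close>
      by (intro exI[of _ "{None}"] exI[of _ "- {None}"])
        (auto simp: open_option_def vimage_def)
  next
    case (Some a)
    show ?thesis
    proof (cases y)
      case None
      then show ?thesis using \<open>x \<noteq> y\<close>
        by (intro exI[of _ "- {None}"] exI[of _ "{None}"])
          (auto simp: open_option_def vimage_def)
    next
      case b: (Some b)
      then obtain U V where "open U" "open V" "a \<in> U" "b \<in> V" "U \<inter> V = {}"
        using hausdorff[of a b] Some \<open>x \<noteq> y\<close> by blast
      then show ?thesis using Some b
        by (intro exI[of _ "Some ` U"] exI[of _ "Some ` V"])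
          (auto simp: open_option_def inj_vimage_image_eq)
    qed
  qed
qed

definition neg_hess_nao :: "('p::finite) c2 \<Rightarrow> (real^'p) option \<Rightarrow> (real^'p^'p) option" where
  "neg_hess_nao q d = map_option (\<lambda>\<delta>. - hess (c2_fun q) \<delta>) d"

definition sqrt_nao :: "(real^'p^'p) option \<Rightarrow> (real^'p^'p) option" where
  "sqrt_nao A = Option.bind A (\<lambda>S. if pos_def S then Some (sym_sqrt S) else NaO)"

definition mult_nao :: "(real^'p^'p) option \<Rightarrow> (real^'p) option \<Rightarrow> (real^'p) option" where
  "mult_nao A v = Option.bind A (\<lambda>S. map_option (\<lambda>x. S *v x) v)"


section \<open>Newton maps\<close>

definition newton_step :: "('p::finite) c2 \<Rightarrow> (real^'p) option \<Rightarrow> (real^'p) option" where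
  "newton_step q d = Option.bind d (\<lambda>\<delta>.
     if pos_def (- hess (c2_fun q) \<delta>)
     then Some (\<delta> + matrix_inv (- hess (c2_fun q) \<delta>) *v grad (c2_fun q) \<delta>)
     else NaO)"

definition newton_seq :: "('p::finite) c2 \<Rightarrow> (real^'p) option \<Rightarrow> nat \<Rightarrow> (real^'p) option" where
  "newton_seq q d m = (newton_step q ^^ m) d"

definition newton_inf :: "('p::finite) c2 \<Rightarrow> (real^'p) option \<Rightarrow> (real^'p) option" where
  "newton_inf q d = (if convergent (newton_seq q d) then lim (newton_seq q d) else NaO)"


section \<open>Convergence in law and conditional distributions\<close>

definition conv_in_law ::
  "(nat \<Rightarrow> 'a measure) \<Rightarrow> (nat \<Rightarrow> 'a \<Rightarrow> 's::topological_space) \<Rightarrow> 'b measure \<Rightarrow> ('b \<Rightarrow> 's) \<Rightarrow> bool"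
where
  "conv_in_law M X N Y \<longleftrightarrow>
     (\<forall>n. X n \<in> borel_measurable (M n)) \<and> Y \<in> borel_measurable N \<and>
     (\<forall>h :: 's \<Rightarrow> real. continuous_on UNIV h \<and> bounded (range h) \<longrightarrow>
        (\<lambda>n. \<integral>\<omega>. h (X n \<omega>) \<partial>M n) \<longlonglongrightarrow> (\<integral>\<omega>. h (Y \<omega>) \<partial>N))"

text \<open>The Markov kernel \<open>\<kappa>\<close> is a regular conditional distribution of \<open>Z\<close> given \<open>K\<close> under \<open>M\<close>.\<close>

definition has_cond_distr ::
  "'a measure \<Rightarrow> ('a \<Rightarrow> 'z::topological_space) \<Rightarrow> ('a \<Rightarrow> 'k::topological_space) \<Rightarrow>
     ('k \<Rightarrow> 'z measure) \<Rightarrow> bool"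
where
  "has_cond_distr M Z K \<kappa> \<longleftrightarrow>
     Z \<in> borel_measurable M \<and> K \<in> borel_measurable M \<and> \<kappa> \<in> borel \<rightarrow>\<^sub>M prob_algebra borel \<and>
     (\<forall>B\<in>sets borel. AE x in M.
        real_cond_exp M (vimage_algebra (space M) K borel) (\<lambda>x. indicator B (Z x)) x
          = measure (\<kappa> (K x)) B)"


section \<open>Parametric models and log likelihoods\<close>

definition model_law :: "'x measure \<Rightarrow> (real^'p \<Rightarrow> 'x \<Rightarrow> real) \<Rightarrow> real^'p \<Rightarrow> 'x measure" where
  "model_law \<mu> f \<delta> = density \<mu> (\<lambda>x. ennreal (f \<delta> x))"

text \<open>\<open>f \<delta>\<close> is the density with respect to \<open>\<mu>\<close> of the data for parameter value \<open>\<delta>\<close>. ``Almost surely''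
  refers to every law in the model.\<close>

definition parametric_model :: "'x measure \<Rightarrow> (real^'p \<Rightarrow> 'x \<Rightarrow> real) \<Rightarrow> bool" where
  "parametric_model \<mu> f \<longleftrightarrow>
     (\<forall>\<delta>. f \<delta> \<in> borel_measurable \<mu> \<and> (\<forall>x\<in>space \<mu>. 0 \<le> f \<delta> x) \<and>
          prob_space (model_law \<mu> f \<delta>)) \<and>
     (\<forall>\<theta> \<delta>. AE x in model_law \<mu> f \<theta>. 0 < f \<delta> x)"

text \<open>\<open>q\<close> is the log likelihood (a random element of \<open>C\<^sup>2\<close> on \<open>M\<close>) for data \<open>X\<close> distributed according
  to the true parameter value zero. The null set takes care of sample points at which
  \<open>\<delta> \<mapsto> u x + ln (f \<delta> x)\<close> is undefined somewhere or not twice continuously differentiable.\<close>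

definition log_likelihood ::
  "'a measure \<Rightarrow> ('a \<Rightarrow> 'x) \<Rightarrow> 'x measure \<Rightarrow> (real^('p::finite) \<Rightarrow> 'x \<Rightarrow> real) \<Rightarrow> ('a \<Rightarrow> 'p c2) \<Rightarrow> bool"
where
  "log_likelihood M X \<mu> f q \<longleftrightarrow>
     parametric_model \<mu> f \<and> X \<in> M \<rightarrow>\<^sub>M \<mu> \<and> distr M \<mu> X = model_law \<mu> f 0 \<and>
     q \<in> borel_measurable M \<and>
     (\<exists>u :: 'x \<Rightarrow> real. AE \<omega> in M. \<forall>\<delta>.
        0 < f \<delta> (X \<omega>) \<and> c2_fun (q \<omega>) \<delta> = u (X \<omega>) + ln (f \<delta> (X \<omega>)))"

definition quad_loglik :: "real^'p \<Rightarrow> real^'p^'p \<Rightarrow> real^'p \<Rightarrow> real" where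
  "quad_loglik Z K \<delta> = \<delta> \<bullet> Z - (1/2) * (\<delta> \<bullet> (K *v \<delta>))"

text \<open>\<open>Z\<close> and \<open>K\<close> are statistics on the sample space of the model.\<close>

definition LAMN_model ::
  "'x measure \<Rightarrow> (real^'p \<Rightarrow> 'x \<Rightarrow> real) \<Rightarrow> ('x \<Rightarrow> real^'p) \<Rightarrow> ('x \<Rightarrow> real^'p^'p) \<Rightarrow> bool"
where
  "LAMN_model \<mu> f Z K \<longleftrightarrow>
     parametric_model \<mu> f \<and> Z \<in> borel_measurable \<mu> \<and> K \<in> borel_measurable \<mu> \<and>
     (\<forall>\<theta>. AE x in model_law \<mu> f \<theta>.
        \<exists>c. \<forall>\<delta>. 0 < f \<delta> x \<and> ln (f \<delta> x) = c + quad_loglik (Z x) (K x) \<delta>) \<and>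
     (\<forall>\<theta>. AE x in model_law \<mu> f \<theta>. pos_semidef (K x)) \<and>
     (\<forall>\<theta>. distr (model_law \<mu> f \<theta>) borel K = distr (model_law \<mu> f 0) borel K) \<and>
     (\<forall>\<theta>. has_cond_distr (model_law \<mu> f \<theta>) Z K (\<lambda>k. mvn (k *v \<theta>) k))"

end

theory Submission
  imports Defs
begin

text \<open>
  The limit only has to be computed at quadratic log likelihoods. If \<open>q(\<delta>) = \<delta>'z - \<delta>'K\<delta>/2\<close> with \<open>K\<close>
  positive definite, a single Newton step from any point lands on \<open>K\<^sup>-\<^sup>1z\<close>, and the infinite-step map is
  continuous at every such pair \<open>(q, \<delta>)\<close>. Almost surely the limit \<open>(q, \<delta>)\<close> is such a pair, so the
  continuous mapping theorem carries \<open>(q\<^sub>n, \<delta>\<^sub>n)\<close> and everything computed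
  from it to the limit, all components at once, and (a)--(d) are projections of that one convergence.

  Continuity at a quadratic (\<open>newton_inf_near_quadratic\<close>): let \<open>g\<close> be \<open>C\<^sup>2\<close>-close to \<open>q\<close> on a large ball around
  \<open>K\<^sup>-\<^sup>1z\<close>. The Newton step of \<open>g\<close> sends the whole ball into a small one, and each step is at most half
  as long as its predecessor, because the gradient left over after a step is controlled by the oscillation of the
  Hessian, which is small since the Hessian of \<open>q\<close> is constant. So the iterates converge, within the small
  ball. The definition of positive
  definiteness includes symmetry, hence the Hessians have to be symmetric (\<open>hess_symmetric\<close>).

  For the studentised estimator the symmetric square root must be continuous; this follows from
  \<open>\<parallel>R - S\<parallel>\<^sup>2 \<le> \<parallel>R\<^sup>2 - S\<^sup>2\<parallel>\<close> for positive semidefinite \<open>R\<close>, \<open>S\<close> (\<open>pos_semidef_sqrt_Hoelder\<close>), which also gives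
  uniqueness. The limit variable is \<open>W = K\<^sup>1\<^sup>/\<^sup>2K\<^sup>-\<^sup>1Z\<close>. Given \<open>K\<close>, the vector \<open>Z\<close> is distributed as \<open>K\<^sup>1\<^sup>/\<^sup>2\<xi>\<close> with
  \<open>\<xi>\<close> standard normal, so that \<open>W\<close> is distributed as \<open>K\<^sup>1\<^sup>/\<^sup>2K\<^sup>-\<^sup>1K\<^sup>1\<^sup>/\<^sup>2\<xi> = \<xi>\<close> whatever \<open>K\<close> is (\<open>distr_standardised\<close>).

  The space \<open>C\<^sup>2\<close> enters through its topology alone. The continuous mapping theorem
  (\<open>continuous_mapping\<close>) rests on the increasing sequence of pseudometrics given by suprema over balls, and
  joint measurability of pairs on a countable base of the other, Euclidean factors
  (\<open>borel_measurable_Pair_second_countable\<close>).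
\<close>


section \<open>Symmetric matrices and their square roots\<close>

lemma norm_matrix_vector_mult_le:
  fixes A :: "real^'n^'m"
  shows "norm (A *v x) \<le> norm A * norm x"
proof -
  have "norm (A *v x) = L2_set (\<lambda>i. norm (A $ i \<bullet> x)) UNIV"
    by (simp add: norm_vec_def matrix_mult_dot)
  also have "\<dots> \<le> L2_set (\<lambda>i. norm x * norm (A $ i)) UNIV"
    by (intro L2_set_mono) (auto simp: mult.commute[of "norm x"] Cauchy_Schwarz_ineq2)
  also have "\<dots> = norm A * norm x"
    by (simp add: L2_set_right_distrib[symmetric] norm_vec_def)
  finally show ?thesis .
qed

lemma symmetric_inner_mult:
  fixes A :: "real^'n^'n"
  assumes "transpose A = A"
  shows "x \<bullet> (A *v y) = (A *v x) \<bullet> y"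
  using dot_lmul_matrix[of x A y] transpose_matrix_vector[of A x] assms by simp

text \<open>A maximiser \<open>v\<close> of the Rayleigh quotient on \<open>S\<close> is an eigenvector: perturbing it in the direction of the
  residual \<open>w = Av - cv\<close> would otherwise increase the quotient to first order.\<close>

lemma rayleigh_eigenvector:
  fixes A :: "real^'n^'n"
  assumes sym: "transpose A = A" and S: "subspace S" and inv: "\<And>x. x \<in> S \<Longrightarrow> A *v x \<in> S"
    and ne: "\<exists>x\<in>S. x \<noteq> 0"
  shows "\<exists>v\<in>S. norm v = 1 \<and> (\<exists>c. A *v v = c *\<^sub>R v)"
proof -
  obtain x0 where x0: "x0 \<in> S" "x0 \<noteq> 0" using ne by blast
  let ?K = "S \<inter> sphere 0 1"
  have "compact ?K"
    using closed_subspace[OF S] by (simp add: closed_Int_compact)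
  moreover have "x0 /\<^sub>R norm x0 \<in> ?K"
    using x0 subspace_scale[OF S] by auto
  then have "?K \<noteq> {}" by blast
  moreover have "continuous_on ?K (\<lambda>x. x \<bullet> (A *v x))"
    by (intro continuous_intros)
  ultimately obtain v where v: "v \<in> ?K" and max: "\<And>x. x \<in> ?K \<Longrightarrow> x \<bullet> (A *v x) \<le> v \<bullet> (A *v v)"
    using continuous_attains_sup[of ?K "\<lambda>x. x \<bullet> (A *v x)"] by blast
  define c where "c = v \<bullet> (A *v v)"
  have vS: "v \<in> S" and nv: "v \<bullet> v = 1"
    using v by (auto simp: dot_square_norm)
  have le: "x \<bullet> (A *v x) \<le> c * (x \<bullet> x)" if "x \<in> S" for x
  proof (cases "x = 0")
    case False
    have "x /\<^sub>R norm x \<in> ?K" using False that subspace_scale[OF S] by auto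
    from max[OF this] have "(x \<bullet> (A *v x)) / (norm x)\<^sup>2 \<le> c"
      by (simp add: c_def matrix_vector_mult_scaleR power2_eq_square divide_simps)
    then show ?thesis using False by (simp add: divide_le_eq dot_square_norm)
  qed simp
  \<comment> \<open>moving from \<open>v\<close> by \<open>tw\<close> gains \<open>2t(w \<bullet> w)\<close> to first order and loses at most \<open>t\<^sup>2m\<close>\<close>
  define w where "w = A *v v - c *\<^sub>R v"
  have wS: "w \<in> S" unfolding w_def using inv[OF vS] vS S
    by (simp add: subspace_diff subspace_scale)
  define m where "m = c * (w \<bullet> w) - w \<bullet> (A *v w)"
  have m0: "0 \<le> m" using le[OF wS] by (simp add: m_def)
  have key: "2 * t * (w \<bullet> w) \<le> t\<^sup>2 * m" for t
  proof -
    have "v + t *\<^sub>R w \<in> S" using vS wS S by (simp add: subspace_add subspace_scale)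
    from le[OF this] have "(v + t *\<^sub>R w) \<bullet> (A *v (v + t *\<^sub>R w)) \<le> c * ((v + t *\<^sub>R w) \<bullet> (v + t *\<^sub>R w))" .
    moreover have "(v + t *\<^sub>R w) \<bullet> (A *v (v + t *\<^sub>R w)) = c + 2 * t * (w \<bullet> (A *v v)) + t\<^sup>2 * (w \<bullet> (A *v w))"
      using symmetric_inner_mult[OF sym, of v w]
      by (simp add: c_def matrix_vector_right_distrib matrix_vector_mult_scaleR inner_add_left inner_add_right
          power2_eq_square algebra_simps inner_commute)
    moreover have "(v + t *\<^sub>R w) \<bullet> (v + t *\<^sub>R w) = 1 + 2 * t * (w \<bullet> v) + t\<^sup>2 * (w \<bullet> w)"
      using nv by (simp add: inner_add_left inner_add_right power2_eq_square algebra_simps inner_commute)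
    moreover have "w \<bullet> w = w \<bullet> (A *v v) - c * (w \<bullet> v)"
      by (simp add: w_def inner_diff_right)
    ultimately have "2 * t * (w \<bullet> (A *v v)) - 2 * t * (c * (w \<bullet> v)) \<le> t\<^sup>2 * (c * (w \<bullet> w)) - t\<^sup>2 * (w \<bullet> (A *v w))"
      by (simp add: distrib_left mult.left_commute)
    then show ?thesis
      by (simp add: m_def \<open>w \<bullet> w = w \<bullet> (A *v v) - c * (w \<bullet> v)\<close> right_diff_distrib)
  qed
  have "w \<bullet> w = 0"
  proof (rule ccontr)
    assume "w \<bullet> w \<noteq> 0"
    then have pos: "0 < w \<bullet> w" by simp
    define t where "t = (w \<bullet> w) / (m + 1)"
    have t: "0 < t" using pos m0 by (simp add: t_def)
    have "t * (2 * (w \<bullet> w)) \<le> t * (t * m)" using key[of t] by (simp add: power2_eq_square algebra_simps)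
    then have "2 * (w \<bullet> w) \<le> t * m" using t by simp
    also have "t * m \<le> w \<bullet> w" using pos m0 by (simp add: t_def field_simps)
    finally show False using pos by simp
  qed
  then have "A *v v = c *\<^sub>R v" by (simp add: w_def)
  then show ?thesis using v by auto
qed

definition eigenbasis :: "real^'n^'n \<Rightarrow> (real^'n) set \<Rightarrow> (real^'n) set \<Rightarrow> bool" where
  "eigenbasis A S B \<longleftrightarrow> finite B \<and> B \<subseteq> S \<and> pairwise orthogonal B \<and> (\<forall>b\<in>B. norm b = 1) \<and>
     span B = S \<and> (\<forall>b\<in>B. \<exists>c. A *v b = c *\<^sub>R b)"

text \<open>The orthogonal complement of an eigenvector inside an invariant subspace is again invariant, so the
  basis is collected by induction on the dimension.\<close>

lemma eigenbasis_exists: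
  fixes A :: "real^'n^'n"
  assumes sym: "transpose A = A"
  shows "subspace S \<Longrightarrow> (\<And>x. x \<in> S \<Longrightarrow> A *v x \<in> S) \<Longrightarrow> \<exists>B. eigenbasis A S B"
proof (induction "dim S" arbitrary: S rule: less_induct)
  case less
  note S = less.prems(1) and inv = less.prems(2)
  show ?case
  proof (cases "\<exists>x\<in>S. x \<noteq> 0")
    case False
    then have "S = {0}" using subspace_0[OF S] by auto
    then show ?thesis by (intro exI[of _ "{}"]) (simp add: eigenbasis_def)
  next
    case True
    obtain v c where v: "v \<in> S" "norm v = 1" and c: "A *v v = c *\<^sub>R v"
      using rayleigh_eigenvector[OF sym S inv True] by blast
    define T where "T = {x \<in> S. v \<bullet> x = 0}"
    have T: "subspace T"
      using S by (auto simp: T_def subspace_def inner_add_right)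
    have invT: "A *v x \<in> T" if "x \<in> T" for x
      using that inv symmetric_inner_mult[OF sym, of v x] c by (auto simp: T_def)
    have vv: "v \<bullet> v = 1" using v by (simp add: dot_square_norm)
    have "T \<subset> S" using v vv by (force simp: T_def)
    then have "dim T < dim S"
      using T S by (metis dim_psubset span_eq_iff)
    from less.hyps[OF this T invT] obtain B where B: "eigenbasis A T B" by blast
    have BT: "B \<subseteq> T" "span B = T" using B by (auto simp: eigenbasis_def)
    have "span (insert v B) = S"
    proof
      show "span (insert v B) \<subseteq> S"
        using v BT S by (intro span_minimal) (auto simp: T_def)
      show "S \<subseteq> span (insert v B)"
      proof
        fix x assume x: "x \<in> S"
        have "x - (v \<bullet> x) *\<^sub>R v \<in> T"
          using x v S vv by (auto simp: T_def subspace_diff subspace_scale inner_diff_right)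
        then show "x \<in> span (insert v B)"
          using BT by (auto simp: span_insert)
      qed
    qed
    moreover have "pairwise orthogonal (insert v B)"
      using B BT by (auto simp: eigenbasis_def pairwise_insert orthogonal_def T_def inner_commute)
    ultimately have "eigenbasis A S (insert v B)"
      using B BT v c by (auto simp: eigenbasis_def T_def)
    then show ?thesis by blast
  qed
qed

text \<open>The spectral theorem in the form used below: an orthonormal expansion and the eigenvalues.\<close>

lemma eigenbasis_UNIV:
  fixes A :: "real^'n^'n"
  assumes "transpose A = A"
  obtains B d where "finite B" "\<And>b c. b \<in> B \<Longrightarrow> c \<in> B \<Longrightarrow> b \<bullet> c = (if b = c then 1 else 0)"
    "\<And>x. (\<Sum>b\<in>B. (b \<bullet> x) *\<^sub>R b) = x" "\<And>b. b \<in> B \<Longrightarrow> A *v b = d b *\<^sub>R b"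
proof -
  obtain B where B: "eigenbasis A UNIV B"
    using eigenbasis_exists[OF assms, of UNIV] by auto
  then have fin: "finite B" and sp: "span B = UNIV" by (auto simp: eigenbasis_def)
  have on: "b \<bullet> c = (if b = c then 1 else 0)" if "b \<in> B" "c \<in> B" for b c
    using B that by (auto simp: eigenbasis_def pairwise_def orthogonal_def dot_square_norm)
  have ex: "(\<Sum>b\<in>B. (b \<bullet> x) *\<^sub>R b) = x" for x
  proof -
    define y where "y = x - (\<Sum>b\<in>B. (b \<bullet> x) *\<^sub>R b)"
    have "orthogonal y c" if "c \<in> B" for c
    proof -
      have "(\<Sum>b\<in>B. (b \<bullet> x) * (c \<bullet> b)) = (\<Sum>b\<in>B. if c = b then b \<bullet> x else 0)"
        using that by (intro sum.cong) (auto simp: on)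
      then show ?thesis using that fin
        by (simp add: y_def orthogonal_def inner_commute[of _ c] inner_diff_right inner_sum_right)
    qed
    then have "orthogonal y y"
      using orthogonal_to_span[of y B y] sp by auto
    then show ?thesis by (simp add: y_def orthogonal_self)
  qed
  obtain d where "\<And>b. b \<in> B \<Longrightarrow> A *v b = d b *\<^sub>R b"
    using bchoice[of B "\<lambda>b c. A *v b = c *\<^sub>R b"] B unfolding eigenbasis_def by auto
  from that[OF fin on ex this] show ?thesis by simp
qed

lemma norm_orthonormal_sum:
  assumes "finite B" "\<And>b c. b \<in> B \<Longrightarrow> c \<in> B \<Longrightarrow> b \<bullet> c = (if b = c then 1 else (0::real))"
  shows "(norm (\<Sum>b\<in>B. f b *\<^sub>R b))\<^sup>2 = (\<Sum>b\<in>B. (f b)\<^sup>2)"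
proof -
  have "(\<Sum>b\<in>B. f b *\<^sub>R b) \<bullet> (\<Sum>b\<in>B. f b *\<^sub>R b) = (\<Sum>b\<in>B. f b * (\<Sum>c\<in>B. if c = b then f b else 0))"
    by (simp add: inner_sum_left inner_sum_right assms(2) if_distrib cong: if_cong sum.cong)
  also have "\<dots> = (\<Sum>b\<in>B. (f b)\<^sup>2)"
    using assms(1) by (simp add: power2_eq_square)
  finally show ?thesis by (simp add: power2_norm_eq_inner)
qed

lemma pos_def_imp_semidef: "pos_def A \<Longrightarrow> pos_semidef A"
proof -
  assume A: "pos_def A"
  have "0 \<le> x \<bullet> (A *v x)" for x
    using A by (cases "x = 0") (auto simp: pos_def_def less_imp_le)
  then show ?thesis using A by (auto simp: pos_def_def pos_semidef_def)
qed

lemma pos_semidef_sqrt_exists: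
  fixes A :: "real^'n^'n"
  assumes "pos_semidef A"
  shows "\<exists>R. pos_semidef R \<and> R ** R = A"
proof -
  have sym: "transpose A = A" and psd: "\<And>x. 0 \<le> x \<bullet> (A *v x)"
    using assms by (auto simp: pos_semidef_def)
  obtain B d where fin: "finite B" and on: "\<And>b c. b \<in> B \<Longrightarrow> c \<in> B \<Longrightarrow> b \<bullet> c = (if b = c then 1 else 0)"
    and ex: "\<And>x. (\<Sum>b\<in>B. (b \<bullet> x) *\<^sub>R b) = x" and d: "\<And>b. b \<in> B \<Longrightarrow> A *v b = d b *\<^sub>R b"
    by (rule eigenbasis_UNIV[OF sym]) blast
  have d0: "0 \<le> d b" if "b \<in> B" for b
    using psd[of b] d[OF that] on[OF that that] by simp
  define r where "r x = (\<Sum>b\<in>B. (sqrt (d b) * (b \<bullet> x)) *\<^sub>R b)" for x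
  have lin: "linear r"
    unfolding r_def by (intro linearI)
      (simp_all add: inner_add_right scaleR_add_left distrib_left sum.distrib scaleR_sum_right algebra_simps)
  define R where "R = matrix r"
  have R: "R *v x = r x" for x
    using lin by (simp add: R_def matrix_works)
  have dot: "x \<bullet> r y = (\<Sum>b\<in>B. sqrt (d b) * (b \<bullet> x) * (b \<bullet> y))" for x y
    by (simp add: r_def inner_sum_right inner_commute algebra_simps)
  have "R $ i $ j = R $ j $ i" for i j
  proof -
    have "R $ i $ j = axis i 1 \<bullet> r (axis j 1)"
      by (simp add: R_def matrix_def inner_axis')
    also have "\<dots> = axis j 1 \<bullet> r (axis i 1)"
      by (simp add: dot mult.commute mult.left_commute)
    also have "\<dots> = R $ j $ i"
      by (simp add: R_def matrix_def inner_axis')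
    finally show ?thesis .
  qed
  then have "transpose R = R"
    by (simp add: transpose_def vec_eq_iff)
  moreover have "0 \<le> x \<bullet> (R *v x)" for x
    unfolding R dot by (intro sum_nonneg) (simp add: d0 mult.assoc)
  moreover have "(R ** R) *v x = A *v x" for x
  proof -
    have rb: "r b = sqrt (d b) *\<^sub>R b" if "b \<in> B" for b
    proof -
      have "r b = (\<Sum>c\<in>B. if c = b then sqrt (d b) *\<^sub>R b else 0)"
        unfolding r_def using that by (intro sum.cong) (auto simp: on)
      then show ?thesis using that fin by simp
    qed
    have "(R ** R) *v x = r (r x)" by (simp add: matrix_vector_mul_assoc[symmetric] R)
    also have "\<dots> = (\<Sum>b\<in>B. (sqrt (d b) * (b \<bullet> x)) *\<^sub>R r b)"
      by (subst r_def[of x]) (simp add: linear_sum[OF lin] linear_scale[OF lin])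
    also have "\<dots> = (\<Sum>b\<in>B. (b \<bullet> x) *\<^sub>R (A *v b))"
      using d0 by (intro sum.cong) (auto simp: rb d)
    also have "\<dots> = A *v (\<Sum>b\<in>B. (b \<bullet> x) *\<^sub>R b)"
      by (simp add: linear_sum[OF matrix_vector_mul_linear] linear_scale[OF matrix_vector_mul_linear])
    finally show ?thesis by (simp add: ex)
  qed
  ultimately show ?thesis
    by (metis matrix_eq pos_semidef_def)
qed

text \<open>Put \<open>D = R - S\<close>. Then \<open>R\<^sup>2 - S\<^sup>2 = RD + DS\<close>, so a unit eigenvector \<open>b\<close> of \<open>D\<close> with eigenvalue \<open>d\<close>
  satisfies \<open>b'(R\<^sup>2 - S\<^sup>2)b = d(b'Rb + b'Sb)\<close>, while \<open>\<bar>d\<bar> = \<bar>b'Rb - b'Sb\<bar> \<le> b'Rb + b'Sb\<close> because both forms are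
  nonnegative. Hence \<open>d\<^sup>2 \<le> \<parallel>R\<^sup>2 - S\<^sup>2\<parallel>\<close> for every eigenvalue of \<open>D\<close>. Equal squares give uniqueness of the
  square root, close squares its continuity.\<close>

lemma pos_semidef_sqrt_Hoelder:
  fixes R S :: "real^'n^'n"
  assumes "pos_semidef R" "pos_semidef S"
  shows "(norm ((R - S) *v x))\<^sup>2 \<le> norm (R ** R - S ** S) * (norm x)\<^sup>2"
proof -
  define D where "D = R - S"
  define E where "E = R ** R - S ** S"
  have sR: "transpose R = R" and sS: "transpose S = S" and pR: "\<And>x. 0 \<le> x \<bullet> (R *v x)"
    and pS: "\<And>x. 0 \<le> x \<bullet> (S *v x)" using assms by (auto simp: pos_semidef_def)
  have sD: "transpose D = D"
    using sR sS by (simp add: D_def transpose_def vec_eq_iff)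
  obtain B d where fin: "finite B" and on: "\<And>b c. b \<in> B \<Longrightarrow> c \<in> B \<Longrightarrow> b \<bullet> c = (if b = c then 1 else 0)"
    and ex: "\<And>x. (\<Sum>b\<in>B. (b \<bullet> x) *\<^sub>R b) = x" and d: "\<And>b. b \<in> B \<Longrightarrow> D *v b = d b *\<^sub>R b"
    by (rule eigenbasis_UNIV[OF sD]) blast
  have ED: "E *v v = R *v (D *v v) + D *v (S *v v)" for v
    by (simp add: E_def D_def matrix_vector_mult_diff_rdistrib matrix_vector_mult_diff_distrib
        flip: matrix_vector_mul_assoc)
  have db: "(d b)\<^sup>2 \<le> norm E" if b: "b \<in> B" for b
  proof -
    have nb: "norm b = 1" using on[OF b b] by (simp add: norm_eq_1)
    define r s where "r = b \<bullet> (R *v b)" and "s = b \<bullet> (S *v b)"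
    have rs: "0 \<le> r" "0 \<le> s" using pR pS by (auto simp: r_def s_def)
    have "d b = r - s"
      using arg_cong[OF d[OF b], of "\<lambda>v. b \<bullet> v"] on[OF b b]
      by (simp add: D_def r_def s_def matrix_vector_mult_diff_rdistrib inner_diff_right)
    then have "\<bar>d b\<bar> \<le> r + s" using rs by auto
    then have "(d b)\<^sup>2 \<le> \<bar>d b\<bar> * (r + s)"
      by (metis abs_ge_zero mult_left_mono power2_abs power2_eq_square)
    also have "\<dots> = \<bar>b \<bullet> (E *v b)\<bar>"
    proof -
      have "b \<bullet> (E *v b) = d b * (r + s)"
        using d[OF b] symmetric_inner_mult[OF sD, of b "S *v b"]
        by (simp add: ED inner_add_right matrix_vector_mult_scaleR r_def s_def algebra_simps)
      then show ?thesis using rs by (simp add: abs_mult)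
    qed
    also have "\<dots> \<le> norm b * norm (E *v b)" by (rule Cauchy_Schwarz_ineq2)
    also have "\<dots> \<le> norm E" using norm_matrix_vector_mult_le[of E b] by (simp add: nb)
    finally show ?thesis .
  qed
  have "D *v x = D *v (\<Sum>b\<in>B. (b \<bullet> x) *\<^sub>R b)" by (simp add: ex)
  also have "\<dots> = (\<Sum>b\<in>B. (d b * (b \<bullet> x)) *\<^sub>R b)"
    by (simp add: linear_sum[OF matrix_vector_mul_linear] linear_scale[OF matrix_vector_mul_linear] d mult.commute)
  finally have "(norm (D *v x))\<^sup>2 = (\<Sum>b\<in>B. (d b * (b \<bullet> x))\<^sup>2)"
    by (simp add: norm_orthonormal_sum[OF fin on])
  also have "\<dots> \<le> (\<Sum>b\<in>B. norm E * (b \<bullet> x)\<^sup>2)"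
    by (intro sum_mono) (simp add: power_mult_distrib db mult_right_mono)
  also have "\<dots> = norm E * (norm (\<Sum>b\<in>B. (b \<bullet> x) *\<^sub>R b))\<^sup>2"
    by (simp add: norm_orthonormal_sum[OF fin on] sum_distrib_left)
  finally show ?thesis by (simp add: D_def E_def ex)
qed

lemma sym_sqrt_unique:
  fixes A :: "real^'n^'n"
  assumes "pos_semidef R" "R ** R = A"
  shows "sym_sqrt A = R"
  unfolding sym_sqrt_def
proof (rule the_equality)
  fix S assume "pos_semidef S \<and> S ** S = A"
  then have "(norm ((S - R) *v x))\<^sup>2 \<le> 0" for x
    using pos_semidef_sqrt_Hoelder[of S R x] assms by simp
  then have "S *v x = R *v x" for x
    by (simp add: matrix_vector_mult_diff_rdistrib)
  then show "S = R" by (simp add: matrix_eq)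
qed (use assms in simp)

lemma sym_sqrt:
  fixes A :: "real^'n^'n"
  assumes "pos_semidef A"
  shows "pos_semidef (sym_sqrt A)" and "sym_sqrt A ** sym_sqrt A = A"
proof -
  obtain R where R: "pos_semidef R" "R ** R = A"
    using pos_semidef_sqrt_exists[OF assms] by auto
  then have "sym_sqrt A = R" by (rule sym_sqrt_unique)
  with R show "pos_semidef (sym_sqrt A)" "sym_sqrt A ** sym_sqrt A = A" by auto
qed

lemma sym_sqrt_mat_1: "sym_sqrt (mat 1 :: real^'n^'n) = mat 1"
  by (intro sym_sqrt_unique) (auto simp: pos_semidef_def)

lemma continuous_on_sym_sqrt: "continuous_on {A :: real^'n^'n. pos_semidef A} sym_sqrt"
  unfolding continuous_on_def
proof
  fix A :: "real^'n^'n" assume A: "A \<in> {A. pos_semidef A}"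
  let ?F = "at A within {A. pos_semidef A}"
  have bd: "\<bar>sym_sqrt S $ i $ j - sym_sqrt A $ i $ j\<bar> \<le> sqrt (norm (S - A))" if "pos_semidef S" for S i j
  proof -
    let ?D = "sym_sqrt S - sym_sqrt A"
    have "(?D *v axis j 1) $ i = sym_sqrt S $ i $ j - sym_sqrt A $ i $ j"
      by (simp add: matrix_vector_mul_component inner_axis)
    then have "\<bar>sym_sqrt S $ i $ j - sym_sqrt A $ i $ j\<bar> \<le> norm (?D *v axis j 1)"
      using component_le_norm_cart[of "?D *v axis j 1" i] by simp
    also have "\<dots> \<le> sqrt (norm (S - A))"
      using pos_semidef_sqrt_Hoelder[OF sym_sqrt(1)[OF that] sym_sqrt(1), of A "axis j 1"] A that
      by (intro real_le_rsqrt) (simp add: sym_sqrt(2))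
    finally show ?thesis .
  qed
  have lim: "((\<lambda>S. sqrt (norm (S - A))) \<longlongrightarrow> 0) ?F"
    by (intro tendsto_eq_intros | simp)+
  show "(sym_sqrt \<longlongrightarrow> sym_sqrt A) ?F"
  proof (intro vec_tendstoI)
    fix i j
    show "((\<lambda>S. sym_sqrt S $ i $ j) \<longlongrightarrow> sym_sqrt A $ i $ j) ?F"
      by (rule Lim_null_comparison[where g = "\<lambda>S. sqrt (norm (S - A))", THEN LIM_zero_cancel, OF _ lim])
        (auto simp: eventually_at_filter bd)
  qed
qed


section \<open>Positive definite matrices and measurable matrix operations\<close>

lemma positive_form_coercive:
  fixes A :: "real^'n^'n"
  assumes "\<And>x. x \<noteq> 0 \<Longrightarrow> 0 < x \<bullet> (A *v x)"
  obtains l where "0 < l" "\<And>x. l * (norm x)\<^sup>2 \<le> x \<bullet> (A *v x)"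
proof -
  have "sphere (0::real^'n) 1 \<noteq> {}" by simp
  moreover have "continuous_on (sphere 0 1) (\<lambda>x. x \<bullet> (A *v x))"
    by (intro continuous_intros)
  ultimately obtain v where v: "v \<in> sphere 0 1"
    and min: "\<And>x. x \<in> sphere 0 1 \<Longrightarrow> v \<bullet> (A *v v) \<le> x \<bullet> (A *v x)"
    using continuous_attains_inf[of "sphere 0 1" "\<lambda>x. x \<bullet> (A *v x)"] by auto
  have "v \<noteq> 0" using v by auto
  show thesis
  proof (rule that)
    show "0 < v \<bullet> (A *v v)" using assms[OF \<open>v \<noteq> 0\<close>] .
    show "v \<bullet> (A *v v) * (norm x)\<^sup>2 \<le> x \<bullet> (A *v x)" for x
    proof (cases "x = 0")
      case False
      then have "x /\<^sub>R norm x \<in> sphere 0 1" by simp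
      from min[OF this] have "v \<bullet> (A *v v) \<le> (x \<bullet> (A *v x)) / (norm x)\<^sup>2"
        by (simp add: matrix_vector_mult_scaleR power2_eq_square divide_simps)
      then show ?thesis using False by (simp add: le_divide_eq)
    qed simp
  qed
qed

lemma coercive_perturb:
  fixes A B :: "real^'n^'n"
  assumes "\<And>x. l * (norm x)\<^sup>2 \<le> x \<bullet> (A *v x)" "norm (B - A) \<le> e"
  shows "(l - e) * (norm x)\<^sup>2 \<le> x \<bullet> (B *v x)"
proof -
  have "\<bar>x \<bullet> ((B - A) *v x)\<bar> \<le> norm x * norm ((B - A) *v x)" by (rule Cauchy_Schwarz_ineq2)
  also have "\<dots> \<le> norm x * (e * norm x)"
    using order_trans[OF norm_matrix_vector_mult_le[of "B - A" x] mult_right_mono[OF assms(2)]]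
    by (intro mult_left_mono) auto
  finally have "\<bar>x \<bullet> (B *v x) - x \<bullet> (A *v x)\<bar> \<le> e * (norm x)\<^sup>2"
    by (simp add: matrix_vector_mult_diff_rdistrib inner_diff_right power2_eq_square algebra_simps)
  with assms(1)[of x] show ?thesis by (simp add: algebra_simps)
qed

lemma open_positive_form: "open {A :: real^'n^'n. \<forall>x. x \<noteq> 0 \<longrightarrow> 0 < x \<bullet> (A *v x)}"
proof (unfold open_dist, safe)
  fix A :: "real^'n^'n" assume "\<forall>x. x \<noteq> 0 \<longrightarrow> 0 < x \<bullet> (A *v x)"
  then obtain l where l: "0 < l" "\<And>x. l * (norm x)\<^sup>2 \<le> x \<bullet> (A *v x)"
    using positive_form_coercive[of A] by blast
  have "0 < x \<bullet> (B *v x)" if "dist B A < l" "x \<noteq> 0" for B :: "real^'n^'n" and x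
  proof -
    have "0 < (l - norm (B - A)) * (norm x)\<^sup>2" using that by (simp add: dist_norm)
    then show ?thesis using coercive_perturb[OF l(2), of B "norm (B - A)" x] by simp
  qed
  with l(1) show "\<exists>e>0. \<forall>y. dist y A < e \<longrightarrow> y \<in> {A. \<forall>x. x \<noteq> 0 \<longrightarrow> 0 < x \<bullet> (A *v x)}" by blast
qed

lemma continuous_on_transpose: "continuous_on UNIV (transpose :: real^'n^'m \<Rightarrow> real^'m^'n)"
  unfolding transpose_def by (intro continuous_intros)

lemma sets_pos_def [measurable]: "{A :: real^'n^'n. pos_def A} \<in> sets borel"
proof -
  have "closed {A :: real^'n^'n. transpose A = A}"
    by (intro closed_Collect_eq continuous_on_transpose continuous_on_id)
  then have "{A :: real^'n^'n. transpose A = A} \<inter> {A. \<forall>x. x \<noteq> 0 \<longrightarrow> 0 < x \<bullet> (A *v x)} \<in> sets borel"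
    by (intro sets.Int borel_closed borel_open open_positive_form)
  also have "{A :: real^'n^'n. transpose A = A} \<inter> {A. \<forall>x. x \<noteq> 0 \<longrightarrow> 0 < x \<bullet> (A *v x)} = {A. pos_def A}"
    by (auto simp: pos_def_def)
  finally show ?thesis .
qed

lemma invertible_matrix_inv:
  fixes A :: "real^'n^'n"
  assumes "invertible A"
  shows "A ** matrix_inv A = mat 1" "matrix_inv A ** A = mat 1"
  using someI_ex[OF assms[unfolded invertible_def]] by (auto simp: matrix_inv_def)

lemma pos_def_invertible:
  fixes A :: "real^'n^'n"
  assumes "pos_def A"
  shows "invertible A"
proof -
  have "x = 0" if "A *v x = 0" for x
    using assms that by (force simp: pos_def_def)
  then show ?thesis
    by (simp add: invertible_left_inverse matrix_left_invertible_ker)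
qed

lemma borel_measurable_det:
  fixes A :: "'a \<Rightarrow> real^'n^'n"
  assumes "\<And>i j. (\<lambda>x. A x $ i $ j) \<in> borel_measurable M"
  shows "(\<lambda>x. det (A x)) \<in> borel_measurable M"
  unfolding det_def using assms by simp

lemma borel_measurable_component:
  fixes A :: "'a \<Rightarrow> 'b::second_countable_topology^'n"
  assumes "A \<in> borel_measurable M"
  shows "(\<lambda>x. A x $ i) \<in> borel_measurable M"
  by (rule measurable_compose[OF assms borel_measurable_continuous_onI])
    (intro continuous_on_component continuous_on_id)

lemma borel_measurable_vec_lambda:
  fixes A :: "'a \<Rightarrow> real^'n"
  assumes "\<And>i. (\<lambda>x. A x $ i) \<in> borel_measurable M"
  shows "A \<in> borel_measurable M"
  using assms by (subst borel_measurable_euclidean_space) (auto simp: Basis_vec_def inner_axis)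

lemma borel_measurable_matrix_vector_mult [measurable]:
  fixes A :: "'a \<Rightarrow> real^'n^'m"
  assumes [measurable]: "A \<in> borel_measurable M" "b \<in> borel_measurable M"
  shows "(\<lambda>x. A x *v b x) \<in> borel_measurable M"
  by (rule borel_measurable_vec_lambda)
    (unfold matrix_vector_mul_component, intro borel_measurable_inner borel_measurable_component assms)

text \<open>Cramer's rule makes this measurable on the invertible matrices; at a singular matrix \<open>matrix_inv\<close> is an
  arbitrary but fixed matrix.\<close>

lemma borel_measurable_matrix_inv_mult [measurable]:
  fixes A :: "'a \<Rightarrow> real^'n^'n"
  assumes A[measurable]: "A \<in> borel_measurable M" and b[measurable]: "b \<in> borel_measurable M"
  shows "(\<lambda>x. matrix_inv (A x) *v b x) \<in> borel_measurable M"
proof -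
  have Aij: "(\<lambda>x. A x $ i $ j) \<in> borel_measurable M" for i j
    by (intro borel_measurable_component A)
  have bi: "(\<lambda>x. b x $ i) \<in> borel_measurable M" for i
    by (intro borel_measurable_component b)
  have [measurable]: "(\<lambda>x. det (A x)) \<in> borel_measurable M"
    by (intro borel_measurable_det Aij)
  have [measurable]: "(\<lambda>x. det (\<chi> i j. if j = k then b x $ i else A x $ i $ j)) \<in> borel_measurable M" for k

  proof (intro borel_measurable_det)
    show "(\<lambda>x. (\<chi> i j. if j = k then b x $ i else A x $ i $ j) $ i $ j) \<in> borel_measurable M" for i j
      by (cases "j = k") (simp_all add: Aij bi)
  qed
  have "(\<lambda>x. \<chi> k. det (\<chi> i j. if j = k then b x $ i else A x $ i $ j) / det (A x)) \<in> borel_measurable M"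
    by (rule borel_measurable_vec_lambda) simp
  moreover have "(\<lambda>x. (SOME C::real^'n^'n. False) *v b x) \<in> borel_measurable M"
    by measurable
  ultimately have *: "(\<lambda>x. if det (A x) = 0 then (SOME C::real^'n^'n. False) *v b x
      else \<chi> k. det (\<chi> i j. if j = k then b x $ i else A x $ i $ j) / det (A x)) \<in> borel_measurable M"
    by measurable
  have "matrix_inv (A x) *v b x = (if det (A x) = 0 then (SOME C::real^'n^'n. False) *v b x
      else \<chi> k. det (\<chi> i j. if j = k then b x $ i else A x $ i $ j) / det (A x))" for x
  proof (cases "det (A x) = 0")
    case True
    then have "\<not> invertible (A x)" by (simp add: invertible_det_nz)
    then have "(\<lambda>C. A x ** C = mat 1 \<and> C ** A x = mat 1) = (\<lambda>C. False)"
      unfolding invertible_def by blast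
    then show ?thesis using True by (simp add: matrix_inv_def)
  next
    case False
    then have "A x *v (matrix_inv (A x) *v b x) = b x"
      by (simp add: matrix_vector_mul_assoc invertible_matrix_inv invertible_det_nz)
    then show ?thesis using False cramer[OF False] by simp
  qed
  with * show ?thesis by simp
qed

text \<open>The square root is replaced by zero off the positive definite matrices because its
  defining description need not denote anything there.\<close>

lemma borel_measurable_sym_sqrt:
  "(\<lambda>A :: real^'n^'n. if pos_def A then sym_sqrt A else 0) \<in> borel_measurable borel"
proof -
  have "continuous_on {A :: real^'n^'n. pos_def A} sym_sqrt"
    by (rule continuous_on_subset[OF continuous_on_sym_sqrt]) (auto simp: pos_def_imp_semidef)
  then have "(\<lambda>A :: real^'n^'n. if A \<in> {A. pos_def A} then sym_sqrt A else 0) \<in> borel_measurable borel"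
    by (intro borel_measurable_continuous_on_if sets_pos_def continuous_on_const)
  then show ?thesis by simp
qed


section \<open>Second derivatives and the topology of \<open>C\<^sup>2\<close>\<close>

lemma twice_cont_diff_has_derivative:
  assumes "twice_cont_diff f"
  shows "(f has_derivative (\<lambda>h. grad f x \<bullet> h)) (at x)"
    and "(grad f has_derivative (\<lambda>h. hess f x *v h)) (at x)"
proof -
  let ?D = "frechet_derivative f (at x)"
  have D: "(f has_derivative ?D) (at x)"
    using assms unfolding twice_cont_diff_def frechet_derivative_works by blast
  have lin: "linear ?D" using has_derivative_linear[OF D] .
  have "?D h = grad f x \<bullet> h" for h
  proof -
    have "?D h = ?D (\<Sum>i\<in>UNIV. (h $ i) *\<^sub>R axis i 1)"
      using basis_expansion[of h] by (simp add: scalar_mult_eq_scaleR)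
    also have "\<dots> = (\<Sum>i\<in>UNIV. h $ i * ?D (axis i 1))"
      by (simp add: linear_sum[OF lin] linear_scale[OF lin])
    finally show ?thesis by (simp add: grad_def inner_vec_def mult.commute)
  qed
  then have "?D = (\<lambda>h. grad f x \<bullet> h)" by auto
  then show "(f has_derivative (\<lambda>h. grad f x \<bullet> h)) (at x)" using D by simp
  show "(grad f has_derivative (\<lambda>h. hess f x *v h)) (at x)"
    using assms unfolding twice_cont_diff_def hess_def jacobian_works by blast
qed

text \<open>Two applications of the mean value theorem, first along \<open>a\<close> and then along \<open>b\<close>. The left-hand side is
  symmetric in \<open>a\<close> and \<open>b\<close>, which forces the mixed derivatives to agree in the limit.\<close>

lemma second_difference:
  fixes f :: "real^'a \<Rightarrow> real"
  assumes f: "twice_cont_diff f" and t: "0 < t"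
  shows "\<exists>r s. 0 < r \<and> r < t \<and> 0 < s \<and> s < t \<and>
    f (x + t *\<^sub>R a + t *\<^sub>R b) - f (x + t *\<^sub>R a) - f (x + t *\<^sub>R b) + f x =
      t\<^sup>2 * ((hess f (x + r *\<^sub>R a + s *\<^sub>R b) *v b) \<bullet> a)"
proof -
  define \<phi> where "\<phi> r = f (x + r *\<^sub>R a + t *\<^sub>R b) - f (x + r *\<^sub>R a)" for r
  have f': "((\<lambda>r. f (x + r *\<^sub>R a + c)) has_real_derivative grad f (x + r *\<^sub>R a + c) \<bullet> a) (at r)" for r and c :: "real^'a"
    unfolding has_field_derivative_def
    by (rule has_derivative_eq_rhs, rule has_derivative_compose[where g = f, OF _ twice_cont_diff_has_derivative(1)[OF f]])
      (auto intro!: derivative_eq_intros)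
  have g': "((\<lambda>s. grad f (c + s *\<^sub>R b) \<bullet> a) has_real_derivative (hess f (c + s *\<^sub>R b) *v b) \<bullet> a) (at s)" for s c
    unfolding has_field_derivative_def
    by (rule has_derivative_eq_rhs, rule has_derivative_inner_left,
        rule has_derivative_compose[where g = "grad f", OF _ twice_cont_diff_has_derivative(2)[OF f]])
      (auto intro!: derivative_eq_intros simp: matrix_vector_mult_scaleR)
  have "(\<phi> has_real_derivative (grad f (x + r *\<^sub>R a + t *\<^sub>R b) \<bullet> a - grad f (x + r *\<^sub>R a) \<bullet> a)) (at r)" for r
    unfolding \<phi>_def using f'[of "t *\<^sub>R b" r] f'[of 0 r] by (auto intro!: derivative_intros)
  from MVT2[OF t this] obtain r where r: "0 < r" "r < t"
    "\<phi> t - \<phi> 0 = (t - 0) * (grad f (x + r *\<^sub>R a + t *\<^sub>R b) \<bullet> a - grad f (x + r *\<^sub>R a) \<bullet> a)" by blast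
  from MVT2[OF t g', of "x + r *\<^sub>R a"] obtain s where s: "0 < s" "s < t"
    "grad f (x + r *\<^sub>R a + t *\<^sub>R b) \<bullet> a - grad f (x + r *\<^sub>R a + 0 *\<^sub>R b) \<bullet> a =
      (t - 0) * ((hess f (x + r *\<^sub>R a + s *\<^sub>R b) *v b) \<bullet> a)" by blast
  have "f (x + t *\<^sub>R a + t *\<^sub>R b) - f (x + t *\<^sub>R a) - f (x + t *\<^sub>R b) + f x = \<phi> t - \<phi> 0"
    by (simp add: \<phi>_def)
  also have "\<dots> = t\<^sup>2 * ((hess f (x + r *\<^sub>R a + s *\<^sub>R b) *v b) \<bullet> a)"
    using r s by (simp add: power2_eq_square)
  finally show ?thesis using r s by blast
qed

lemma hess_symmetric:
  assumes f: "twice_cont_diff f"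
  shows "transpose (hess f x) = hess f x"
proof -
  have "(hess f x *v b) \<bullet> a = (hess f x *v a) \<bullet> b" if n: "norm a = 1" "norm b = 1" for a b
  proof -
    have "\<bar>(hess f x *v b) \<bullet> a - (hess f x *v a) \<bullet> b\<bar> \<le> e" if e: "0 < e" for e
    proof -
      have "isCont (hess f) x"
        using f by (simp add: twice_cont_diff_def continuous_on_eq_continuous_at)
      then obtain d where d: "0 < d" "\<And>y. dist y x < d \<Longrightarrow> dist (hess f y) (hess f x) < e / 2"
        using e unfolding continuous_at_eps_delta by (meson half_gt_zero)
      have near: "\<bar>(hess f (x + r *\<^sub>R u + s *\<^sub>R v) *v v) \<bullet> u - (hess f x *v v) \<bullet> u\<bar> \<le> e / 2"
        if "0 < r" "r < d / 2" "0 < s" "s < d / 2" "norm u = 1" "norm v = 1" for r s u v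
      proof -
        let ?y = "x + r *\<^sub>R u + s *\<^sub>R v"
        have "dist ?y x \<le> r + s"
          using norm_triangle_ineq[of "r *\<^sub>R u" "s *\<^sub>R v"] that by (simp add: dist_norm add.assoc)
        then have "norm (hess f ?y - hess f x) < e / 2"
          using d(2)[of ?y] that by (simp add: dist_norm)
        moreover have "\<bar>((hess f ?y - hess f x) *v v) \<bullet> u\<bar> \<le> norm (hess f ?y - hess f x)"
          using Cauchy_Schwarz_ineq2[of "(hess f ?y - hess f x) *v v" u]
            norm_matrix_vector_mult_le[of "hess f ?y - hess f x" v] that by simp
        ultimately show ?thesis
          by (simp add: matrix_vector_mult_diff_rdistrib inner_diff_left)
      qed
      define t where "t = d / 2"
      have t: "0 < t" using d by (simp add: t_def)
      obtain r s where rs: "0 < r" "r < t" "0 < s" "s < t"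
        "f (x + t *\<^sub>R a + t *\<^sub>R b) - f (x + t *\<^sub>R a) - f (x + t *\<^sub>R b) + f x =
          t\<^sup>2 * ((hess f (x + r *\<^sub>R a + s *\<^sub>R b) *v b) \<bullet> a)"
        using second_difference[OF f t] by blast
      obtain r' s' where rs': "0 < r'" "r' < t" "0 < s'" "s' < t"
        "f (x + t *\<^sub>R b + t *\<^sub>R a) - f (x + t *\<^sub>R b) - f (x + t *\<^sub>R a) + f x =
          t\<^sup>2 * ((hess f (x + r' *\<^sub>R b + s' *\<^sub>R a) *v a) \<bullet> b)"
        using second_difference[OF f t] by blast
      have "t\<^sup>2 * ((hess f (x + r *\<^sub>R a + s *\<^sub>R b) *v b) \<bullet> a) = t\<^sup>2 * ((hess f (x + r' *\<^sub>R b + s' *\<^sub>R a) *v a) \<bullet> b)"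
        unfolding rs(5)[symmetric] rs'(5)[symmetric] by (simp add: algebra_simps)
      then have "(hess f (x + r *\<^sub>R a + s *\<^sub>R b) *v b) \<bullet> a = (hess f (x + r' *\<^sub>R b + s' *\<^sub>R a) *v a) \<bullet> b"
        using t by simp
      moreover have "\<bar>(hess f (x + r *\<^sub>R a + s *\<^sub>R b) *v b) \<bullet> a - (hess f x *v b) \<bullet> a\<bar> \<le> e / 2"
        using rs n by (intro near) (auto simp: t_def)
      moreover have "\<bar>(hess f (x + r' *\<^sub>R b + s' *\<^sub>R a) *v a) \<bullet> b - (hess f x *v a) \<bullet> b\<bar> \<le> e / 2"
        using rs' n by (intro near) (auto simp: t_def)
      ultimately show ?thesis by linarith
    qed
    then have "\<bar>(hess f x *v b) \<bullet> a - (hess f x *v a) \<bullet> b\<bar> \<le> 0"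
      by (rule field_le_epsilon) simp
    then show ?thesis by simp
  qed
  from this[of "axis i 1" "axis j 1" for i j]
  show ?thesis
    by (simp add: vec_eq_iff transpose_def inner_axis matrix_vector_mult_basis column_def)
qed

lemma c2: "twice_cont_diff (c2_fun q)"
  using c2_fun by auto

lemmas c2_has_derivative = twice_cont_diff_has_derivative[OF c2]

lemma continuous_on_c2:
  "continuous_on S (c2_fun q)" "continuous_on S (grad (c2_fun q))" "continuous_on S (hess (c2_fun q))"
proof -
  show "continuous_on S (c2_fun q)" "continuous_on S (grad (c2_fun q))"
    by (intro continuous_at_imp_continuous_on ballI has_derivative_continuous[OF c2_has_derivative(1)]
        has_derivative_continuous[OF c2_has_derivative(2)])+
  show "continuous_on S (hess (c2_fun q))"
    using c2[of q] continuous_on_subset[of UNIV "hess (c2_fun q)" S] by (simp add: twice_cont_diff_def)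
qed

text \<open>The strict inequalities defining the neighbourhood hold with a margin, by compactness of \<open>C\<close>.\<close>

lemma open_c2_nbhd:
  assumes C: "compact C" and e: "0 < e"
  shows "open (c2_nbhd f C e)"
  unfolding open_c2_def
proof
  fix g assume g: "g \<in> c2_nbhd f C e"
  define m where "m x = max \<bar>c2_fun g x - c2_fun f x\<bar> (max (norm (grad (c2_fun g) x - grad (c2_fun f) x))
    (norm (hess (c2_fun g) x - hess (c2_fun f) x)))" for x
  have "continuous_on C m"
    unfolding m_def by (intro continuous_intros continuous_on_c2)
  then have "\<exists>M<e. \<forall>x\<in>C. m x \<le> M"
  proof (cases "C = {}")
    case False
    then obtain y where y: "y \<in> C" "\<forall>x\<in>C. m x \<le> m y"
      using continuous_attains_sup[OF C False \<open>continuous_on C m\<close>] by blast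
    moreover have "m y < e" using g y(1) by (auto simp: m_def c2_nbhd_def)
    ultimately show ?thesis by blast
  qed (use e in \<open>auto intro: exI[of _ 0]\<close>)
  then obtain M where M: "M < e" "\<And>x. x \<in> C \<Longrightarrow> m x \<le> M" by blast
  have "c2_nbhd g C (e - M) \<subseteq> c2_nbhd f C e"
  proof
    fix h assume h: "h \<in> c2_nbhd g C (e - M)"
    have "\<bar>c2_fun h x - c2_fun f x\<bar> < e \<and> norm (grad (c2_fun h) x - grad (c2_fun f) x) < e \<and>
        norm (hess (c2_fun h) x - hess (c2_fun f) x) < e" if x: "x \<in> C" for x
    proof -
      have 1: "\<bar>c2_fun h x - c2_fun g x\<bar> < e - M" "norm (grad (c2_fun h) x - grad (c2_fun g) x) < e - M"
        "norm (hess (c2_fun h) x - hess (c2_fun g) x) < e - M"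
        using h x by (auto simp: c2_nbhd_def)
      have 2: "\<bar>c2_fun g x - c2_fun f x\<bar> \<le> M" "norm (grad (c2_fun g) x - grad (c2_fun f) x) \<le> M"
        "norm (hess (c2_fun g) x - hess (c2_fun f) x) \<le> M"
        using M(2)[OF x] by (auto simp: m_def)
      show ?thesis
        using 1 2 norm_triangle_ineq[of "grad (c2_fun h) x - grad (c2_fun g) x" "grad (c2_fun g) x - grad (c2_fun f) x"]
          norm_triangle_ineq[of "hess (c2_fun h) x - hess (c2_fun g) x" "hess (c2_fun g) x - hess (c2_fun f) x"]
        by (simp add: add_diff_eq)
    qed
    then show "h \<in> c2_nbhd f C e" by (simp add: c2_nbhd_def)
  qed
  then show "\<exists>D d. compact D \<and> 0 < d \<and> c2_nbhd g D d \<subseteq> c2_nbhd f C e"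
    using C M(1) by (intro exI[of _ C] exI[of _ "e - M"]) auto
qed

lemma c2_nbhd_self: "0 < e \<Longrightarrow> f \<in> c2_nbhd f C e"
  by (simp add: c2_nbhd_def)

lemma eventually_c2_nbhd: "compact C \<Longrightarrow> 0 < e \<Longrightarrow> eventually (\<lambda>g. g \<in> c2_nbhd f C e) (nhds f)"
  by (rule eventually_nhds_in_open[OF open_c2_nbhd c2_nbhd_self])

lemma tendsto_c2_eval:
  fixes f :: "'p::finite c2"
  assumes "(Q \<longlongrightarrow> f) F" "(X \<longlongrightarrow> x) F"
  shows "((\<lambda>t. grad (c2_fun (Q t)) (X t)) \<longlongrightarrow> grad (c2_fun f) x) F"
    and "((\<lambda>t. hess (c2_fun (Q t)) (X t)) \<longlongrightarrow> hess (c2_fun f) x) F"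
proof -
  have ball: "eventually (\<lambda>t. X t \<in> cball x 1) F"
    using tendstoD[OF assms(2), of 1] by (auto elim!: eventually_mono simp: dist_commute)
  have near: "eventually (\<lambda>t. Q t \<in> c2_nbhd f (cball x 1) e) F" if "0 < e" for e
    using assms(1)[unfolded filterlim_iff, rule_format, OF eventually_c2_nbhd[OF compact_cball that]] .
  have lim: "((\<lambda>t. grad (c2_fun f) (X t)) \<longlongrightarrow> grad (c2_fun f) x) F"
    "((\<lambda>t. hess (c2_fun f) (X t)) \<longlongrightarrow> hess (c2_fun f) x) F"
    using continuous_on_tendsto_compose[OF continuous_on_c2(2)[of UNIV] assms(2)]
      continuous_on_tendsto_compose[OF continuous_on_c2(3)[of UNIV] assms(2)] by auto
  show "((\<lambda>t. grad (c2_fun (Q t)) (X t)) \<longlongrightarrow> grad (c2_fun f) x) F"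
  proof (rule Lim_transform[OF lim(1)], rule tendstoI)
    fix e :: real assume "0 < e"
    from near[OF this] ball show "eventually (\<lambda>t. dist (grad (c2_fun (Q t)) (X t) - grad (c2_fun f) (X t)) 0 < e) F"
      by eventually_elim (auto simp: c2_nbhd_def)
  qed
  show "((\<lambda>t. hess (c2_fun (Q t)) (X t)) \<longlongrightarrow> hess (c2_fun f) x) F"
  proof (rule Lim_transform[OF lim(2)], rule tendstoI)
    fix e :: real assume "0 < e"
    from near[OF this] ball show "eventually (\<lambda>t. dist (hess (c2_fun (Q t)) (X t) - hess (c2_fun f) (X t)) 0 < e) F"
      by eventually_elim (auto simp: c2_nbhd_def)
  qed
qed


section \<open>NaO and pairs of random elements\<close>

lemma continuous_on_Some: "continuous_on UNIV Some"
  by (simp add: continuous_on_open_vimage open_option_def)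

lemma continuous_on_case_option: "continuous_on UNIV (case_option c (\<lambda>x. x))"
proof (simp add: continuous_on_open_vimage open_option_def, safe)
  fix B :: "'a set" assume "open B"
  moreover have "Some -` (case_option c (\<lambda>x. x) -` B) = B" by auto
  ultimately show "open (Some -` (case_option c (\<lambda>x. x) -` B))" by simp
qed

lemma open_option_None: "open {None}" and open_option_Some: "open S \<Longrightarrow> open (Some ` S)"
proof -
  show "open {None}" by (simp add: open_option_def vimage_def)
  show "open S \<Longrightarrow> open (Some ` S)" by (simp add: open_option_def inj_vimage_image_eq)
qed

instance option :: (second_countable_topology) second_countable_topology
proof
  obtain B :: "'a set set" where B: "countable B" "topological_basis B"
    using ex_countable_basis by blast
  have "topological_basis (insert {None} ((`) Some ` B))"
  proof (rule topological_basisI)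
    show "open b" if "b \<in> insert {None} ((`) Some ` B)" for b
      using that B(2) by (auto intro: open_option_None open_option_Some topological_basis_open)
    fix U :: "'a option set" and x assume U: "open U" "x \<in> U"
    show "\<exists>b\<in>insert {None} ((`) Some ` B). x \<in> b \<and> b \<subseteq> U"
    proof (cases x)
      case (Some a)
      then obtain b where "b \<in> B" "a \<in> b" "b \<subseteq> Some -` U"
        using topological_basisE[OF B(2), of "Some -` U" a] U unfolding open_option_def by auto
      then show ?thesis using Some by (intro bexI[of _ "Some ` b"]) auto
    qed (use U in auto)
  qed
  then show "\<exists>B::'a option set set. countable B \<and> open = generate_topology B"
    using B(1) by (intro exI[of _ "insert {None} ((`) Some ` B)"]) (simp add: topological_basis_imp_subbasis)
qed

lemma borel_measurable_Some [measurable]: "Some \<in> borel_measurable borel"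
  by (rule borel_measurable_continuous_onI[OF continuous_on_Some])

lemma borel_measurable_case_option [measurable]: "case_option c (\<lambda>x. x) \<in> borel_measurable borel"
  by (rule borel_measurable_continuous_onI[OF continuous_on_case_option])

lemma pred_eq_None [measurable]:
  assumes [measurable]: "d \<in> borel_measurable M"
  shows "Measurable.pred M (\<lambda>x. d x = (None :: 'a::topological_space option))"
proof -
  have "{None :: 'a option} \<in> sets borel" by (intro borel_open open_option_None)
  then have "d -` {None} \<inter> space M \<in> sets M" by measurable
  also have "d -` {None} \<inter> space M = {x \<in> space M. d x = None}" by auto
  finally show ?thesis by (simp add: pred_def)
qed

text \<open>Since NaO is isolated, a limit that is not NaO is a limit of vectors; \<open>the\<close> may take any value at the
  indices where NaO still occurs.\<close>

lemma tendsto_Some_iff: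
  fixes l :: "'a::metric_space"
  shows "(f \<longlongrightarrow> Some l) F \<longleftrightarrow> eventually (\<lambda>t. f t \<noteq> None) F \<and> ((\<lambda>t. the (f t)) \<longlongrightarrow> l) F"
proof safe
  assume f: "(f \<longlongrightarrow> Some l) F"
  have "open (- {None :: 'a option})" by (simp add: open_option_def vimage_def)
  from topological_tendstoD[OF f this] show ev: "eventually (\<lambda>t. f t \<noteq> None) F" by simp
  have "((\<lambda>t. case_option l (\<lambda>x. x) (f t)) \<longlongrightarrow> l) F"
    using continuous_on_tendsto_compose[OF continuous_on_case_option[of l] f] by simp
  then show "((\<lambda>t. the (f t)) \<longlongrightarrow> l) F"
    by (rule Lim_transform_eventually) (use ev in eventually_elim, auto)
next
  assume "eventually (\<lambda>t. f t \<noteq> None) F" "((\<lambda>t. the (f t)) \<longlongrightarrow> l) F"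
  then show "(f \<longlongrightarrow> Some l) F"
    using continuous_on_tendsto_compose[OF continuous_on_Some, of "\<lambda>t. the (f t)" l F]
    by (auto elim!: Lim_transform_eventually eventually_mono)
qed

text \<open>An open set of the product is the union of the boxes \<open>A b \<times> b\<close>, where \<open>b\<close> runs through a countable base of
  the second factor and \<open>A b\<close> is the largest open set whose box fits. This serves pairs whose first
  component lies in \<open>C\<^sup>2\<close>.\<close>

lemma borel_measurable_Pair_second_countable:
  fixes f :: "'a \<Rightarrow> 's::topological_space" and g :: "'a \<Rightarrow> 't::second_countable_topology"
  assumes f: "f \<in> borel_measurable M" and g: "g \<in> borel_measurable M"
  shows "(\<lambda>x. (f x, g x)) \<in> borel_measurable M"
proof (rule borel_measurableI)
  fix S :: "('s \<times> 't) set" assume S: "open S"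
  obtain B :: "'t set set" where B: "countable B" "topological_basis B"
    using ex_countable_basis by blast
  define A where "A b = \<Union>{A. open A \<and> A \<times> b \<subseteq> S}" for b
  have A: "open (A b)" for b by (auto simp: A_def)
  have "S = (\<Union>b\<in>B. A b \<times> b)"
  proof safe
    fix x y assume "(x, y) \<in> S"
    then obtain U V where UV: "open U" "open V" "x \<in> U" "y \<in> V" "U \<times> V \<subseteq> S"
      using S by (auto elim!: open_prod_elim)
    then obtain b where "b \<in> B" "y \<in> b" "b \<subseteq> V"
      using topological_basisE[OF B(2)] by metis
    then have "open U \<and> U \<times> b \<subseteq> S" using UV by blast
    then have "x \<in> A b" using UV(3) by (auto simp: A_def)
    with \<open>b \<in> B\<close> \<open>y \<in> b\<close> show "(x, y) \<in> (\<Union>b\<in>B. A b \<times> b)" by blast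
  qed (auto simp: A_def)
  then have "(\<lambda>x. (f x, g x)) -` S \<inter> space M = (\<Union>b\<in>B. (f -` A b \<inter> space M) \<inter> (g -` b \<inter> space M))"
    by auto
  also have "\<dots> \<in> sets M"
    using measurable_sets[OF f borel_open[OF A]] measurable_sets[OF g borel_open[OF topological_basis_open[OF B(2)]]]
    by (intro sets.countable_UN'[OF B(1)] subsetI) auto
  finally show "(\<lambda>x. (f x, g x)) -` S \<inter> space M \<in> sets M" .
qed


section \<open>Convergence in law under almost surely continuous maps\<close>

text \<open>An increasing sequence of continuous pseudometrics that together generate the topology. For
  \<open>C\<^sup>2\<close> these are suprema over balls of growing radius.\<close>

locale pseudometric_family =
  fixes \<rho> :: "nat \<Rightarrow> 's::topological_space \<Rightarrow> 's \<Rightarrow> real"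
  assumes self: "\<rho> k x x = 0" and sym: "\<rho> k x y = \<rho> k y x"
    and triangle: "\<rho> k x z \<le> \<rho> k x y + \<rho> k y z"
    and mono: "k \<le> l \<Longrightarrow> \<rho> k x y \<le> \<rho> l x y"
    and nhds: "0 < e \<Longrightarrow> eventually (\<lambda>y. \<rho> k x y < e) (nhds x)"
    and basis: "open U \<Longrightarrow> x \<in> U \<Longrightarrow> \<exists>k e. 0 < e \<and> {y. \<rho> k x y < e} \<subseteq> U"
begin

lemma nonneg: "0 \<le> \<rho> k x y"
  using triangle[of k x x y] by (simp add: self sym)

text \<open>The inf-convolution with \<open>k \<rho>\<^sub>k\<close>: the greatest function below \<open>\<phi>\<close> that is \<open>k\<close>-Lipschitz for \<open>\<rho>\<^sub>k\<close>.\<close>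

definition lower :: "('s \<Rightarrow> real) \<Rightarrow> nat \<Rightarrow> 's \<Rightarrow> real" where
  "lower \<phi> k x = (INF y. \<phi> y + k * \<rho> k x y)"

context
  fixes \<phi> :: "'s \<Rightarrow> real" and b :: real
  assumes b: "\<And>x. \<bar>\<phi> x\<bar> \<le> b"
begin

lemma lower_bdd: "bdd_below (range (\<lambda>y. \<phi> y + real k * \<rho> k x y))"
proof (rule bdd_belowI2)
  show "- b \<le> \<phi> y + real k * \<rho> k x y" for y
    using b[of y] mult_nonneg_nonneg[of "real k" "\<rho> k x y"] nonneg[of k x y] by linarith
qed

lemma lower_le: "lower \<phi> k x \<le> \<phi> y + k * \<rho> k x y"
  unfolding lower_def by (intro cINF_lower lower_bdd) simp

lemma lower_greatest: "(\<And>y. c \<le> \<phi> y + k * \<rho> k x y) \<Longrightarrow> c \<le> lower \<phi> k x"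
  unfolding lower_def by (intro cINF_greatest) auto

lemma lower_le_self: "lower \<phi> k x \<le> \<phi> x"
  using lower_le[of k x x] by (simp add: self)

lemma lower_bound: "\<bar>lower \<phi> k x\<bar> \<le> b"
proof -
  have "- b \<le> lower \<phi> k x"
    using b nonneg by (intro lower_greatest) (smt (verit) of_nat_0_le_iff split_mult_pos_le)
  then show ?thesis using lower_le_self[of k x] b[of x] by simp
qed

lemma lower_Lipschitz: "lower \<phi> k x - k * \<rho> k x y \<le> lower \<phi> k y"
proof (rule lower_greatest)
  fix z
  have "k * \<rho> k x z \<le> k * \<rho> k x y + k * \<rho> k y z"
    using mult_left_mono[OF triangle[of k x z y], of "real k"] by (simp add: distrib_left)
  then show "lower \<phi> k x - k * \<rho> k x y \<le> \<phi> z + k * \<rho> k y z"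
    using lower_le[of k x z] by simp
qed

lemma continuous_on_lower: "continuous_on UNIV (lower \<phi> k)"
  unfolding continuous_on_def
proof (safe, rule tendstoI)
  fix x :: 's and e :: real assume e: "0 < e"
  have "eventually (\<lambda>y. \<rho> k x y < e / (real k + 1)) (nhds x)"
    using e by (intro nhds) simp
  then have "eventually (\<lambda>y. dist (lower \<phi> k y) (lower \<phi> k x) < e) (nhds x)"
  proof eventually_elim
    case (elim y)
    have "real k * \<rho> k x y \<le> (real k + 1) * \<rho> k x y"
      using nonneg[of k x y] by (simp add: distrib_right)
    also have "\<dots> < e"
      using elim by (simp add: field_simps)
    finally show ?case
      using lower_Lipschitz[of k x y] lower_Lipschitz[of k y x] sym[of k x y]
      by (simp add: dist_real_def abs_less_iff)
  qed
  then show "eventually (\<lambda>y. dist (lower \<phi> k y) (lower \<phi> k x) < e) (at x within UNIV)"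
    by (simp add: eventually_at_filter eventually_mono)
qed

text \<open>Near \<open>x\<close> the values of \<open>\<phi>\<close> are close to \<open>\<phi> x\<close>, and far from \<open>x\<close> the penalty \<open>k \<rho>\<^sub>k\<close> makes up for the oscillation \<open>2b\<close>
  for large \<open>k\<close>. The limit along the full filter \<open>nhds x\<close>, which includes \<open>x\<close> itself, has to be \<open>\<phi> x\<close>.\<close>

lemma lower_tendsto:
  assumes "(\<phi> \<longlongrightarrow> c) (nhds x)"
  shows "(\<lambda>k. lower \<phi> k x) \<longlonglongrightarrow> c"
proof (rule tendstoI)
  fix e :: real assume e: "0 < e"
  have c: "c = \<phi> x"
  proof (rule ccontr)
    assume "c \<noteq> \<phi> x"
    then have "eventually (\<lambda>y. dist (\<phi> y) c < dist (\<phi> x) c) (nhds x)"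
      by (intro tendstoD[OF assms]) simp
    then show False by (auto dest: eventually_nhds_x_imp_x)
  qed
  have "eventually (\<lambda>y. dist (\<phi> y) (\<phi> x) < e / 2) (nhds x)"
    using assms e unfolding c by (intro tendstoD) auto
  then obtain U where U: "open U" "x \<in> U" "\<And>y. y \<in> U \<Longrightarrow> dist (\<phi> y) (\<phi> x) < e / 2"
    unfolding eventually_nhds by blast
  obtain k0 d where d: "0 < d" "\<And>y. \<rho> k0 x y < d \<Longrightarrow> y \<in> U"
    using basis[OF U(1,2)] by blast
  obtain k1 where k1: "2 * b / d \<le> real k1" using real_arch_simple by blast
  have "dist (lower \<phi> k x) (\<phi> x) < e" if k: "max k0 k1 \<le> k" for k
  proof -
    have "\<phi> x - e / 2 \<le> lower \<phi> k x"
    proof (rule lower_greatest)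
      fix y
      show "\<phi> x - e / 2 \<le> \<phi> y + real k * \<rho> k x y"
      proof (cases "\<rho> k0 x y < d")
        case True
        then show ?thesis
          using U(3)[OF d(2)[OF True]] mult_nonneg_nonneg[OF of_nat_0_le_iff[of k] nonneg[of k x y]]
          unfolding dist_real_def by linarith
      next
        case False
        have "2 * b \<le> real k1 * d" using k1 d(1) by (simp add: divide_le_eq)
        also have "\<dots> \<le> real k * \<rho> k x y"
          using k False mono[of k0 k x y] d(1) by (intro mult_mono) auto
        finally show ?thesis using b[of x] b[of y] e by (simp add: abs_le_iff)
      qed
    qed
    then show ?thesis using lower_le_self[of k x] e by (simp add: dist_real_def)
  qed
  then show "eventually (\<lambda>k. dist (lower \<phi> k x) c < e) sequentially"
    unfolding c eventually_sequentially by blast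
qed

text \<open>A continuous minorant of \<open>\<phi>\<close> whose expectation in the limit is within \<open>e\<close> transfers the lower bound. The
  limit value is a separate function \<open>\<psi>\<close> because \<open>\<phi> \<circ> Y\<close> agrees with it only almost surely and may fail to be
  measurable.\<close>

lemma conv_in_law_liminf:
  assumes M: "\<And>n. prob_space (M n)" and N: "prob_space N" and conv: "conv_in_law M X N Y"
    and meas: "\<And>n. (\<lambda>\<omega>. \<phi> (X n \<omega>)) \<in> borel_measurable (M n)"
    and \<psi>: "\<psi> \<in> borel_measurable N" "AE \<omega> in N. (\<phi> \<longlongrightarrow> \<psi> \<omega>) (nhds (Y \<omega>))"
    and e: "0 < e"
  shows "eventually (\<lambda>n. (\<integral>\<omega>. \<psi> \<omega> \<partial>N) - e < (\<integral>\<omega>. \<phi> (X n \<omega>) \<partial>M n)) sequentially"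
proof -
  interpret N: prob_space N by fact
  have X[measurable]: "\<And>n. X n \<in> borel_measurable (M n)" and Y[measurable]: "Y \<in> borel_measurable N"
    using conv by (auto simp: conv_in_law_def)
  have lower[measurable]: "lower \<phi> k \<in> borel_measurable borel" for k
    by (rule borel_measurable_continuous_onI[OF continuous_on_lower])
  have "(\<lambda>k. \<integral>\<omega>. lower \<phi> k (Y \<omega>) \<partial>N) \<longlonglongrightarrow> (\<integral>\<omega>. \<psi> \<omega> \<partial>N)"
  proof (rule integral_dominated_convergence[where w = "\<lambda>_. b"])
    show "AE \<omega> in N. (\<lambda>k. lower \<phi> k (Y \<omega>)) \<longlonglongrightarrow> \<psi> \<omega>"
      using \<psi>(2) by eventually_elim (rule lower_tendsto)
  qed (use \<psi>(1) in \<open>auto simp: lower_bound\<close>)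
  then have "eventually (\<lambda>k. (\<integral>\<omega>. \<psi> \<omega> \<partial>N) - e < (\<integral>\<omega>. lower \<phi> k (Y \<omega>) \<partial>N)) sequentially"
    by (rule order_tendstoD) (use e in simp)
  then obtain k where k: "(\<integral>\<omega>. \<psi> \<omega> \<partial>N) - e < (\<integral>\<omega>. lower \<phi> k (Y \<omega>) \<partial>N)"
    using eventually_happens'[OF sequentially_bot] by blast
  have "bounded (range (lower \<phi> k))"
    using lower_bound by (auto simp: bounded_iff)
  then have "(\<lambda>n. \<integral>\<omega>. lower \<phi> k (X n \<omega>) \<partial>M n) \<longlonglongrightarrow> (\<integral>\<omega>. lower \<phi> k (Y \<omega>) \<partial>N)"
    using conv continuous_on_lower by (auto simp: conv_in_law_def)
  from order_tendstoD(1)[OF this k] show ?thesis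
  proof eventually_elim
    case (elim n)
    interpret Mn: prob_space "M n" by fact
    have "(\<integral>\<omega>. lower \<phi> k (X n \<omega>) \<partial>M n) \<le> (\<integral>\<omega>. \<phi> (X n \<omega>) \<partial>M n)"
      using meas b lower_bound
      by (intro integral_mono Mn.integrable_const_bound[where B = b]) (auto simp: lower_le_self)
    with elim show ?case by simp
  qed
qed

end

text \<open>Applying the lower bound to \<open>h \<circ> G\<close> and to \<open>- h \<circ> G\<close> gives both inequalities.\<close>

lemma continuous_mapping:
  fixes G :: "'s \<Rightarrow> 't::topological_space"
  assumes M: "\<And>n. prob_space (M n)" and N: "prob_space N" and conv: "conv_in_law M X N Y"
    and meas: "\<And>n. (\<lambda>\<omega>. G (X n \<omega>)) \<in> borel_measurable (M n)"
    and Y': "Y' \<in> borel_measurable N" "AE \<omega> in N. (G \<longlongrightarrow> Y' \<omega>) (nhds (Y \<omega>))"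
  shows "conv_in_law M (\<lambda>n \<omega>. G (X n \<omega>)) N Y'"
  unfolding conv_in_law_def
proof (intro conjI allI impI meas Y'(1))
  fix h :: "'t \<Rightarrow> real" assume h: "continuous_on UNIV h \<and> bounded (range h)"
  then obtain b where b: "\<And>y. \<bar>h y\<bar> \<le> b" by (auto simp: bounded_iff)
  have [measurable]: "h \<in> borel_measurable borel"
    using h by (intro borel_measurable_continuous_onI) simp
  have tend: "((\<lambda>x. h (G x)) \<longlongrightarrow> h z) (nhds y)" if "(G \<longlongrightarrow> z) (nhds y)" for y z
    using h that by (auto intro: continuous_on_tendsto_compose)
  show "(\<lambda>n. \<integral>\<omega>. h (G (X n \<omega>)) \<partial>M n) \<longlonglongrightarrow> (\<integral>\<omega>. h (Y' \<omega>) \<partial>N)"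
  proof (rule tendstoI)
    fix e :: real assume e: "0 < e"
    have 1: "eventually (\<lambda>n. (\<integral>\<omega>. h (Y' \<omega>) \<partial>N) - e < (\<integral>\<omega>. h (G (X n \<omega>)) \<partial>M n)) sequentially"
    proof (rule conv_in_law_liminf[where \<phi> = "\<lambda>x. h (G x)" and b = b, OF b M N conv _ _ _ e])
      show "AE \<omega> in N. ((\<lambda>x. h (G x)) \<longlongrightarrow> h (Y' \<omega>)) (nhds (Y \<omega>))"
        using Y'(2) by eventually_elim (rule tend)
    qed (use Y' meas in auto)
    have 2: "eventually (\<lambda>n. (\<integral>\<omega>. - h (Y' \<omega>) \<partial>N) - e < (\<integral>\<omega>. - h (G (X n \<omega>)) \<partial>M n)) sequentially"
    proof (rule conv_in_law_liminf[where \<phi> = "\<lambda>x. - h (G x)" and b = b, OF _ M N conv _ _ _ e])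
      show "AE \<omega> in N. ((\<lambda>x. - h (G x)) \<longlongrightarrow> - h (Y' \<omega>)) (nhds (Y \<omega>))"
        using Y'(2) by eventually_elim (intro tendsto_minus tend)
    qed (use Y' meas b in auto)
    from 1 2 show "eventually (\<lambda>n. dist (\<integral>\<omega>. h (G (X n \<omega>)) \<partial>M n) (\<integral>\<omega>. h (Y' \<omega>) \<partial>N) < e) sequentially"
      by eventually_elim (simp add: dist_real_def abs_less_iff)
  qed
qed

end

lemma conv_in_law_continuous_image:
  fixes g :: "'s::topological_space \<Rightarrow> 't::topological_space"
  assumes conv: "conv_in_law M X N Y" and g: "continuous_on UNIV g"
  shows "conv_in_law M (\<lambda>n \<omega>. g (X n \<omega>)) N (\<lambda>\<omega>. g (Y \<omega>))"
proof -
  have [measurable]: "g \<in> borel_measurable borel" by (rule borel_measurable_continuous_onI[OF g])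
  have X[measurable]: "\<And>n. X n \<in> borel_measurable (M n)" and Y[measurable]: "Y \<in> borel_measurable N"
    using conv by (auto simp: conv_in_law_def)
  show ?thesis
    unfolding conv_in_law_def
  proof (intro conjI allI impI)
    fix h :: "'t \<Rightarrow> real" assume h: "continuous_on UNIV h \<and> bounded (range h)"
    then have "continuous_on UNIV (\<lambda>x. h (g x)) \<and> bounded (range (\<lambda>x. h (g x)))"
      using continuous_on_compose2[OF _ g, of UNIV h] by (auto elim!: bounded_subset)
    then show "(\<lambda>n. \<integral>\<omega>. h (g (X n \<omega>)) \<partial>M n) \<longlonglongrightarrow> (\<integral>\<omega>. h (g (Y \<omega>)) \<partial>N)"
      using conv unfolding conv_in_law_def by blast
  qed measurable
qed

lemma conv_in_law_distr:
  fixes g :: "'t::topological_space \<Rightarrow> 's::topological_space"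
  assumes conv: "conv_in_law M X N (\<lambda>\<omega>. g (Y \<omega>))"
    and [measurable]: "Y \<in> borel_measurable N" "g \<in> borel_measurable borel"
  shows "conv_in_law M X (distr N borel Y) g"
  unfolding conv_in_law_def
proof (intro conjI allI impI)
  fix h :: "'s \<Rightarrow> real" assume h: "continuous_on UNIV h \<and> bounded (range h)"
  then have [measurable]: "h \<in> borel_measurable borel"
    by (intro borel_measurable_continuous_onI) simp
  have "(\<integral>x. h (g x) \<partial>distr N borel Y) = (\<integral>\<omega>. h (g (Y \<omega>)) \<partial>N)"
    by (rule integral_distr) measurable
  then show "(\<lambda>n. \<integral>\<omega>. h (X n \<omega>) \<partial>M n) \<longlonglongrightarrow> (\<integral>x. h (g x) \<partial>distr N borel Y)"
    using conv h by (simp add: conv_in_law_def)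
qed (use conv in \<open>auto simp: conv_in_law_def\<close>)

definition c2_gap :: "'p::finite c2 \<Rightarrow> 'p c2 \<Rightarrow> real^'p \<Rightarrow> real" where
  "c2_gap f g x = \<bar>c2_fun f x - c2_fun g x\<bar> + norm (grad (c2_fun f) x - grad (c2_fun g) x)
     + norm (hess (c2_fun f) x - hess (c2_fun g) x)"

definition c2_dist :: "nat \<Rightarrow> 'p::finite c2 \<Rightarrow> 'p c2 \<Rightarrow> real" where
  "c2_dist k f g = (SUP x\<in>cball 0 (real k). c2_gap f g x)"

lemma c2_gap_le_dist:
  assumes "x \<in> cball 0 (real k)"
  shows "c2_gap f g x \<le> c2_dist k f g"
proof -
  have "continuous_on (cball 0 (real k)) (c2_gap f g)"
    unfolding c2_gap_def by (intro continuous_intros continuous_on_c2)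
  then have "compact (c2_gap f g ` cball 0 (real k))"
    by (rule compact_continuous_image) simp
  then show ?thesis
    using assms unfolding c2_dist_def
    by (intro cSUP_upper) (auto intro: bounded_imp_bdd_above compact_imp_bounded)
qed

lemma c2_dist_le: "(\<And>x. x \<in> cball 0 (real k) \<Longrightarrow> c2_gap f g x \<le> c) \<Longrightarrow> c2_dist k f g \<le> c"
  unfolding c2_dist_def by (rule cSUP_least) auto

definition c2_vec_dist :: "nat \<Rightarrow> 'p::finite c2 \<times> (real^'p) \<Rightarrow> 'p c2 \<times> (real^'p) \<Rightarrow> real" where
  "c2_vec_dist k x y = c2_dist k (fst x) (fst y) + dist (snd x) (snd y)"

interpretation c2_vec: pseudometric_family "c2_vec_dist :: nat \<Rightarrow> 'p::finite c2 \<times> (real^'p) \<Rightarrow> _"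
proof
  fix k l :: nat and x y z :: "'p c2 \<times> (real^'p)" and e :: real and U :: "('p c2 \<times> (real^'p)) set"
  show "c2_vec_dist k x x = 0"
    by (simp add: c2_vec_dist_def c2_dist_def c2_gap_def)
  show "c2_vec_dist k x y = c2_vec_dist k y x"
    by (simp add: c2_vec_dist_def c2_dist_def c2_gap_def norm_minus_commute abs_minus_commute dist_commute)
  have gap: "c2_gap f h a \<le> c2_gap f g a + c2_gap g h a" for f g h :: "'p c2" and a
    using norm_triangle_ineq[of "grad (c2_fun f) a - grad (c2_fun g) a" "grad (c2_fun g) a - grad (c2_fun h) a"]
      norm_triangle_ineq[of "hess (c2_fun f) a - hess (c2_fun g) a" "hess (c2_fun g) a - hess (c2_fun h) a"]
    by (simp add: c2_gap_def)
  have "c2_dist k f h \<le> c2_dist k f g + c2_dist k g h" for f g h :: "'p c2"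
    by (rule c2_dist_le) (meson gap c2_gap_le_dist add_mono order_trans)
  from this[of "fst x" "fst z" "fst y"]
  show "c2_vec_dist k x z \<le> c2_vec_dist k x y + c2_vec_dist k y z"
    using dist_triangle[of "snd x" "snd z" "snd y"] by (simp add: c2_vec_dist_def)
  show "c2_vec_dist k x y \<le> c2_vec_dist l x y" if "k \<le> l"
    unfolding c2_vec_dist_def using that by (intro add_right_mono c2_dist_le c2_gap_le_dist) auto
  show "eventually (\<lambda>y. c2_vec_dist k x y < e) (nhds x)" if e: "0 < e"
  proof -
    obtain q d where x: "x = (q, d)" by (cases x)
    have "eventually (\<lambda>g. g \<in> c2_nbhd q (cball 0 (real k)) (e / 8)) (nhds q)"
      using e by (intro eventually_c2_nbhd) auto
    moreover have "eventually (\<lambda>a. dist a d < e / 2) (nhds d)"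
      using e unfolding eventually_nhds_metric by (intro exI[of _ "e / 2"]) auto
    ultimately have "eventually (\<lambda>y. fst y \<in> c2_nbhd q (cball 0 (real k)) (e / 8) \<and> dist (snd y) d < e / 2) (nhds x)"
      unfolding x nhds_prod by (auto simp: eventually_prod_filter)
    then show ?thesis
    proof eventually_elim
      case (elim y)
      then have "c2_dist k q (fst y) \<le> 3 * (e / 8)"
        by (intro c2_dist_le) (force simp: c2_nbhd_def c2_gap_def norm_minus_commute abs_minus_commute)
      then show ?case using elim e by (simp add: c2_vec_dist_def x dist_commute)
    qed
  qed
  show "\<exists>k e. 0 < e \<and> {y. c2_vec_dist k x y < e} \<subseteq> U" if U: "open U" "x \<in> U"
  proof -
    obtain q d where x: "x = (q, d)" by (cases x)
    obtain A B where AB: "open A" "open B" "q \<in> A" "d \<in> B" "A \<times> B \<subseteq> U"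
      using U unfolding x by (auto elim!: open_prod_elim)
    obtain C e where C: "compact C" "0 < e" "c2_nbhd q C e \<subseteq> A"
      using AB(1,3) unfolding open_c2_def by blast
    obtain e' where e': "0 < e'" "\<And>a. dist a d < e' \<Longrightarrow> a \<in> B"
      using AB(2,4) unfolding open_dist by blast
    obtain r where "\<And>a. a \<in> C \<Longrightarrow> norm a \<le> r"
      using compact_imp_bounded[OF C(1)] by (auto simp: bounded_iff)
    moreover obtain k where "r \<le> real k" using real_arch_simple by blast
    ultimately have k: "a \<in> cball 0 (real k)" if "a \<in> C" for a
      using that by (auto intro: order_trans)
    have "y \<in> U" if "c2_vec_dist k x y < min e e'" for y
    proof -
      have "0 \<le> c2_dist k q (fst y)"
        using c2_gap_le_dist[of 0 k q "fst y"] by (simp add: c2_gap_def)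
          (smt (verit) norm_ge_zero)
      then have *: "c2_dist k q (fst y) < e" "dist (snd y) d < e'"
        using that zero_le_dist[of d "snd y"] unfolding c2_vec_dist_def x dist_commute[of "snd y"] fst_conv snd_conv
        by linarith+
      have "c2_gap q (fst y) a < e" if "a \<in> C" for a
        using c2_gap_le_dist[OF k[OF that], of q "fst y"] * by simp
      then have "fst y \<in> c2_nbhd q C e"
        unfolding c2_nbhd_def c2_gap_def
        by (auto simp: norm_minus_commute abs_minus_commute) (smt (verit) norm_ge_zero)+
      then show ?thesis using C AB e'(2)[OF *(2)] by (cases y) auto
    qed
    then show ?thesis using C e' by (intro exI[of _ k] exI[of _ "min e e'"]) auto
  qed
qed


section \<open>Newton's method near a strictly concave quadratic\<close>

lemma pos_def_hess_near:
  assumes l: "\<And>x. l * (norm x)\<^sup>2 \<le> x \<bullet> (K *v x)" and e: "norm (- hess (c2_fun g) x - K) \<le> e" "e < l"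
  shows "pos_def (- hess (c2_fun g) x)"
  unfolding pos_def_def
proof safe
  show "transpose (- hess (c2_fun g) x) = - hess (c2_fun g) x"
    using hess_symmetric[OF c2[of g], of x] by (simp add: transpose_def vec_eq_iff)
  show "0 < v \<bullet> (- hess (c2_fun g) x *v v)" if "v \<noteq> 0" for v
  proof -
    have "0 < (l - e) * (norm v)\<^sup>2" using e(2) that by simp
    also have "\<dots> \<le> v \<bullet> (- hess (c2_fun g) x *v v)" by (rule coercive_perturb[OF l e(1)])
    finally show ?thesis .
  qed
qed

lemma coercive_norm_bound:
  fixes H :: "real^'n^'n"
  assumes l: "\<And>x. l * (norm x)\<^sup>2 \<le> x \<bullet> (H *v x)"
  shows "l * norm v \<le> norm (H *v v)"
proof (cases "v = 0")
  case False
  have "l * (norm v)\<^sup>2 \<le> norm v * norm (H *v v)"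
    using l[of v] norm_cauchy_schwarz[of v "H *v v"] by simp
  then show ?thesis using False by (simp add: power2_eq_square mult.left_commute[of l])
qed simp

text \<open>Let \<open>T\<close> be the Newton step of \<open>g\<close>, with length \<open>\<parallel>s\<parallel>\<close>, and \<open>H = - \<nabla>\<^sup>2g\<close>. Since \<open>Kc = z\<close>,
  \<open>H(x)(T x - c) = (H(x) - K)(x - c) + (\<nabla>g(x) - (z - Kx))\<close>, and both terms are of order \<open>e\<close>: all points
  \<open>T x\<close> lie in the ball of radius \<open>r\<close>. The step at \<open>T x\<close> solves \<open>H(T x)s(T x) = \<nabla>g(T x)\<close>, and
  \<open>\<nabla>g(T x)\<close> is the increment from \<open>x\<close> to \<open>T x\<close> of \<open>y \<mapsto> \<nabla>g(y) + H(x)y\<close>, whose derivative \<open>H(x) - H(y)\<close> is at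
  most \<open>2e\<close>. Hence each step is at most half as long as the one before.\<close>

lemma newton_inf_near_quadratic:
  fixes q :: "'p::finite c2"
  assumes l: "0 < l" "\<And>x. l * (norm x)\<^sup>2 \<le> x \<bullet> (K *v x)"
    and q: "\<And>x. grad (c2_fun q) x = z - K *v x" "\<And>x. hess (c2_fun q) x = - K"
    and c: "K *v c = z"
    and r: "0 < r" "r \<le> R" and e: "0 < e" "e \<le> l / 8" "2 * e * (R + 1) \<le> l * r"
    and g: "g \<in> c2_nbhd q (cball c R) e" and d: "dist d c \<le> R"
  shows "\<exists>x. newton_inf g (Some d) = Some x \<and> dist x c \<le> r"
proof -
  let ?f = "c2_fun g"
  define H where "H x = - hess ?f x" for x
  define s where "s x = matrix_inv (H x) *v grad ?f x" for x
  define T where "T x = x + s x" for x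
  have in_ball: "norm (H x - K) \<le> e" "norm (grad ?f x - (z - K *v x)) \<le> e" if "dist x c \<le> R" for x
  proof -
    have "x \<in> cball c R" using that by (simp add: dist_commute)
    then have *: "norm (grad ?f x - grad (c2_fun q) x) < e" "norm (hess ?f x - hess (c2_fun q) x) < e"
      using g by (auto simp: c2_nbhd_def)
    have "H x - K = - (hess ?f x - hess (c2_fun q) x)" by (simp add: H_def q)
    then show "norm (H x - K) \<le> e" using *(2) by (simp only: norm_minus_cancel less_imp_le)
    show "norm (grad ?f x - (z - K *v x)) \<le> e" using *(1) by (simp add: q)
  qed
  have pd: "pos_def (H x)" if "dist x c \<le> R" for x
    unfolding H_def
    by (rule pos_def_hess_near[OF l(2), where e = e]) (use in_ball(1)[OF that] e l(1) in \<open>auto simp: H_def\<close>)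
  have Hbound: "l / 2 * norm v \<le> norm (H x *v v)" if "dist x c \<le> R" for x v
  proof (rule coercive_norm_bound)
    fix v :: "real^'p"
    have "l / 2 * (norm v)\<^sup>2 \<le> (l - e) * (norm v)\<^sup>2"
      using e(2) l(1) by (intro mult_right_mono) auto
    also have "\<dots> \<le> v \<bullet> (H x *v v)"
      by (rule coercive_perturb[OF l(2) in_ball(1)[OF that]])
    finally show "l / 2 * (norm v)\<^sup>2 \<le> v \<bullet> (H x *v v)" .
  qed
  have Hs: "H x *v s x = grad ?f x" if "dist x c \<le> R" for x
    unfolding s_def using invertible_matrix_inv(1)[OF pos_def_invertible[OF pd[OF that]]]
    by (simp add: matrix_vector_mul_assoc)
  have T: "dist (T x) c \<le> r" if x: "dist x c \<le> R" for x
  proof -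
    have "H x *v (T x - c) = (H x - K) *v (x - c) + (grad ?f x - (z - K *v x))"
      using Hs[OF x] c
      by (simp add: T_def matrix_vector_mult_diff_rdistrib matrix_vector_mult_diff_distrib
          matrix_vector_right_distrib)
    also have "norm \<dots> \<le> norm ((H x - K) *v (x - c)) + norm (grad ?f x - (z - K *v x))"
      by (rule norm_triangle_ineq)
    also have "\<dots> \<le> e * R + e"
    proof (intro add_mono in_ball(2)[OF x])
      have "norm ((H x - K) *v (x - c)) \<le> norm (H x - K) * norm (x - c)"
        by (rule norm_matrix_vector_mult_le)
      also have "\<dots> \<le> e * R"
        using in_ball(1)[OF x] x e(1) by (intro mult_mono) (auto simp: dist_norm)
      finally show "norm ((H x - K) *v (x - c)) \<le> e * R" .
    qed
    finally have "l * norm (T x - c) \<le> l * r"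
      using Hbound[OF x, of "T x - c"] e(3) by (simp add: algebra_simps)
    then show ?thesis using l(1) by (simp add: dist_norm)
  qed
  have sT: "norm (s (T x)) \<le> 1 / 2 * norm (s x)" if x: "dist x c \<le> R" for x
  proof -
    have Tx: "dist (T x) c \<le> R" using T[OF x] r by simp
    \<comment> \<open>the linear term is chosen such that the increment of \<open>F\<close> along the Newton step is the new gradient\<close>
    define F where "F y = grad ?f y + H x *v y" for y
    have "norm (F (T x) - F x) \<le> 2 * e * norm (T x - x)"
    proof (rule differentiable_bound[of "cball c R"])
      show "(F has_derivative (\<lambda>h. hess ?f y *v h + H x *v h)) (at y within cball c R)" for y
        unfolding F_def
        by (intro has_derivative_add has_derivative_at_withinI[OF c2_has_derivative(2)]
            has_derivative_mult_right bounded_linear_imp_has_derivative matrix_vector_mul_bounded_linear)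
      fix y assume "y \<in> cball c R"
      then have y: "dist y c \<le> R" by (simp add: dist_commute)
      show "onorm (\<lambda>h. hess ?f y *v h + H x *v h) \<le> 2 * e"
      proof (rule onorm_le)
        fix h
        have "norm (H x - H y) \<le> 2 * e"
          using norm_triangle_ineq4[of "H x - K" "H y - K"] in_ball(1)[OF x] in_ball(1)[OF y] by simp
        then have "norm ((H x - H y) *v h) \<le> 2 * e * norm h"
          by (meson norm_matrix_vector_mult_le mult_right_mono norm_ge_zero order_trans)
        then show "norm (hess ?f y *v h + H x *v h) \<le> 2 * e * norm h"
          by (simp add: H_def matrix_vector_mult_diff_rdistrib matrix_vector_mult_add_rdistrib[symmetric] add.commute)
      qed
    qed (use x Tx in \<open>auto simp: dist_commute\<close>)
    moreover have "F (T x) - F x = grad ?f (T x)"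
      by (simp add: F_def T_def matrix_vector_right_distrib Hs[OF x])
    moreover have "T x - x = s x" by (simp add: T_def)
    ultimately have "norm (H (T x) *v s (T x)) \<le> 2 * e * norm (s x)"
      by (simp only: Hs[OF Tx])
    then have "l / 2 * norm (s (T x)) \<le> l / 4 * norm (s x)"
      using Hbound[OF Tx, of "s (T x)"] mult_right_mono[OF e(2) norm_ge_zero[of "s x"]] by simp
    then have "l * norm (s (T x)) \<le> l * (1 / 2 * norm (s x))" by simp
    then show ?thesis using l(1) by (simp only: mult_le_cancel_left_pos)
  qed
  define x where "x m = (T ^^ m) d" for m
  have xS: "x (Suc m) = T (x m)" for m by (simp add: x_def)
  have xR: "dist (x m) c \<le> R" for m
    using T d r by (induction m) (auto simp: x_def intro: order_trans)
  have xr: "dist (x (Suc m)) c \<le> r" for m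
    unfolding xS by (rule T[OF xR])
  have geo: "norm (s (x m)) \<le> (1 / 2) ^ m * norm (s d)" for m
  proof (induction m)
    case (Suc m)
    then show ?case using sT[OF xR[of m]] by (simp add: xS)
  qed (simp add: x_def)
  have "summable (\<lambda>m. (1 / 2) ^ m * norm (s d))"
    by (intro summable_mult2 summable_geometric) simp
  then have "summable (\<lambda>m. s (x m))"
    by (rule summable_comparison_test') (rule geo)
  then have "summable (\<lambda>m. x (Suc m) - x m)" by (simp add: xS T_def)
  then have "convergent x"
    unfolding summable_iff_convergent sum_lessThan_telescope by (simp add: convergent_diff_const_right_iff)
  then obtain y where y: "x \<longlonglongrightarrow> y" by (auto simp: convergent_def)
  have seq: "newton_seq g (Some d) m = Some (x m)" for m
  proof (induction m)
    case (Suc m)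
    have "newton_seq g (Some d) (Suc m) = newton_step g (Some (x m))"
      using Suc by (simp add: newton_seq_def)
    also have "\<dots> = Some (x (Suc m))"
      using pd[OF xR[of m]] by (simp add: newton_step_def xS T_def s_def H_def)
    finally show ?case .
  qed (simp add: newton_seq_def x_def)
  have nlim: "newton_seq g (Some d) \<longlonglongrightarrow> Some y"
    unfolding tendsto_Some_iff using y by (simp add: seq)
  then have "newton_inf g (Some d) = Some y"
    using limI[OF nlim] convergentI[OF nlim] by (simp add: newton_inf_def)
  moreover have "dist y c \<le> r"
    using tendsto_dist[OF LIMSEQ_Suc[OF y] tendsto_const[of c]] xr by (intro LIMSEQ_le_const2) auto
  ultimately show ?thesis by blast
qed

lemma newton_inf_tendsto:
  fixes q :: "'p::finite c2"
  assumes K: "pos_def K"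
    and q: "\<And>x. grad (c2_fun q) x = z - K *v x" "\<And>x. hess (c2_fun q) x = - K"
    and lim: "(Q \<longlongrightarrow> q) F" "(D \<longlongrightarrow> d) F"
  shows "((\<lambda>t. newton_inf (Q t) (Some (D t))) \<longlongrightarrow> Some (matrix_inv K *v z)) F"
proof -
  define c where "c = matrix_inv K *v z"
  have c: "K *v c = z"
    by (simp add: c_def matrix_vector_mul_assoc invertible_matrix_inv(1)[OF pos_def_invertible[OF K]])
  obtain l where l: "0 < l" "\<And>x. l * (norm x)\<^sup>2 \<le> x \<bullet> (K *v x)"
    using positive_form_coercive[of K] K unfolding pos_def_def by blast
  have ev: "eventually (\<lambda>t. \<exists>x. newton_inf (Q t) (Some (D t)) = Some x \<and> dist x c \<le> r) F" if r: "0 < r" for r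
  proof -
    \<comment> \<open>the ball contains all starting points within distance \<open>1\<close> of \<open>d\<close>\<close>
    define R where "R = dist d c + 1 + r"
    have R: "0 < R + 1" "r \<le> R" using r by (auto simp: R_def add_nonneg_pos)
    define e where "e = min (l / 8) (l * r / (2 * (R + 1)))"
    have "0 < e" using l(1) r R by (simp add: e_def)
    moreover have "e \<le> l / 8" unfolding e_def by (rule min.cobounded1)
    ultimately have e: "0 < e" "e \<le> l / 8" .
    have "e \<le> l * r / (2 * (R + 1))" by (simp add: e_def)
    then have e3: "2 * e * (R + 1) \<le> l * r" using R by (simp add: pos_le_divide_eq algebra_simps)
    have "eventually (\<lambda>t. Q t \<in> c2_nbhd q (cball c R) e) F"
      using lim(1)[unfolded filterlim_iff, rule_format, OF eventually_c2_nbhd[OF compact_cball e(1)]] .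
    moreover have "eventually (\<lambda>t. dist (D t) d < 1) F"
      using lim(2) by (rule tendstoD) simp
    ultimately show ?thesis
    proof eventually_elim
      case (elim t)
      have "dist (D t) c \<le> R" using elim(2) dist_triangle[of "D t" c d] r by (simp add: R_def)
      then show ?case by (rule newton_inf_near_quadratic[OF l q c r R(2) e e3 elim(1)])
    qed
  qed
  show ?thesis
    unfolding c_def[symmetric] tendsto_Some_iff
  proof (intro conjI tendstoI)
    show "eventually (\<lambda>t. newton_inf (Q t) (Some (D t)) \<noteq> None) F"
      using ev[of 1] by (auto elim: eventually_mono)
    fix r :: real assume "0 < r"
    then show "eventually (\<lambda>t. dist (the (newton_inf (Q t) (Some (D t)))) c < r) F"
      using ev[of "r / 2"] by (auto elim!: eventually_mono)
  qed
qed

lemma sym_sqrt_tendsto: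
  fixes K :: "real^'n^'n"
  assumes "(A \<longlongrightarrow> K) F" "eventually (\<lambda>t. pos_def (A t)) F" "pos_def K"
  shows "((\<lambda>t. sym_sqrt (A t)) \<longlongrightarrow> sym_sqrt K) F"
  by (rule continuous_on_tendsto_compose[OF continuous_on_sym_sqrt assms(1)])
    (use assms in \<open>auto intro: pos_def_imp_semidef elim: eventually_mono\<close>)

lemma matrix_vector_mult_tendsto:
  fixes A :: "'t \<Rightarrow> real^'n^'m"
  assumes "(A \<longlongrightarrow> K) F" "(x \<longlongrightarrow> y) F"
  shows "((\<lambda>t. A t *v x t) \<longlongrightarrow> K *v y) F"
  by (intro vec_tendstoI) (simp add: matrix_vector_mul_component, intro tendsto_inner tendsto_vec_nth assms)

lemma newton_outputs_tendsto:
  fixes q :: "'p::finite c2"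
  assumes K: "pos_def K"
    and q: "\<And>x. grad (c2_fun q) x = z - K *v x" "\<And>x. hess (c2_fun q) x = - K"
    and lim: "(Q \<longlongrightarrow> q) F" "(D \<longlongrightarrow> d) F"
  defines "N \<equiv> \<lambda>t. newton_inf (Q t) (Some (D t))" and "c \<equiv> matrix_inv K *v z"
  shows "((\<lambda>t. neg_hess_nao (Q t) (N t)) \<longlongrightarrow> Some K) F"
    and "((\<lambda>t. mult_nao (sqrt_nao (neg_hess_nao (Q t) (N t))) (N t)) \<longlongrightarrow> Some (sym_sqrt K *v c)) F"
proof -
  let ?H = "\<lambda>t. - hess (c2_fun (Q t)) (the (N t))"
  have N: "eventually (\<lambda>t. N t \<noteq> None) F" "((\<lambda>t. the (N t)) \<longlongrightarrow> c) F"
    using newton_inf_tendsto[OF K q lim] by (simp_all add: tendsto_Some_iff N_def c_def)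
  have H: "(?H \<longlongrightarrow> K) F"
    using tendsto_minus[OF tendsto_c2_eval(2)[OF lim(1) N(2)]] by (simp add: q)
  show "((\<lambda>t. neg_hess_nao (Q t) (N t)) \<longlongrightarrow> Some K) F"
    unfolding tendsto_Some_iff
  proof
    show "eventually (\<lambda>t. neg_hess_nao (Q t) (N t) \<noteq> None) F"
      using N(1) by (auto simp: neg_hess_nao_def)
    show "((\<lambda>t. the (neg_hess_nao (Q t) (N t))) \<longlongrightarrow> K) F"
      by (rule Lim_transform_eventually[OF H])
        (use N(1) in eventually_elim, auto simp: neg_hess_nao_def)
  qed
  obtain l where l: "0 < l" "\<And>x. l * (norm x)\<^sup>2 \<le> x \<bullet> (K *v x)"
    using positive_form_coercive[of K] K unfolding pos_def_def by blast
  have pd: "eventually (\<lambda>t. pos_def (?H t)) F"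
    using tendstoD[OF H l(1)]
  proof eventually_elim
    case (elim t)
    then show ?case by (intro pos_def_hess_near[OF l(2) order_refl]) (simp add: dist_norm)
  qed
  have eq: "eventually (\<lambda>t. mult_nao (sqrt_nao (neg_hess_nao (Q t) (N t))) (N t) = Some (sym_sqrt (?H t) *v the (N t))) F"
    using N(1) pd by eventually_elim (auto simp: mult_nao_def sqrt_nao_def neg_hess_nao_def)
  have "((\<lambda>t. sym_sqrt (?H t) *v the (N t)) \<longlongrightarrow> sym_sqrt K *v c) F"
    by (intro matrix_vector_mult_tendsto sym_sqrt_tendsto H pd K N(2))
  then have "((\<lambda>t. Some (sym_sqrt (?H t) *v the (N t))) \<longlongrightarrow> Some (sym_sqrt K *v c)) F"
    by (simp add: tendsto_Some_iff)
  then show "((\<lambda>t. mult_nao (sqrt_nao (neg_hess_nao (Q t) (N t))) (N t)) \<longlongrightarrow> Some (sym_sqrt K *v c)) F"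
    by (rule Lim_transform_eventually) (use eq in eventually_elim, auto)
qed


section \<open>Measurability of the Newton maps\<close>

lemma borel_measurable_c2_eval [measurable]:
  fixes Q :: "'a \<Rightarrow> 'p::finite c2"
  assumes "Q \<in> borel_measurable M" "X \<in> borel_measurable M"
  shows "(\<lambda>\<omega>. grad (c2_fun (Q \<omega>)) (X \<omega>)) \<in> borel_measurable M"
    and "(\<lambda>\<omega>. hess (c2_fun (Q \<omega>)) (X \<omega>)) \<in> borel_measurable M"
proof -
  have pair: "(\<lambda>\<omega>. (Q \<omega>, X \<omega>)) \<in> borel_measurable M"
    by (rule borel_measurable_Pair_second_countable[OF assms])
  have "continuous_on UNIV (\<lambda>p::'p c2 \<times> (real^'p). grad (c2_fun (fst p)) (snd p))"
    "continuous_on UNIV (\<lambda>p::'p c2 \<times> (real^'p). hess (c2_fun (fst p)) (snd p))"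
    unfolding continuous_on_def
    by (intro ballI tendsto_c2_eval tendsto_fst tendsto_snd tendsto_ident_at)+
  from this[THEN borel_measurable_continuous_onI, THEN measurable_compose[OF pair]]
  show "(\<lambda>\<omega>. grad (c2_fun (Q \<omega>)) (X \<omega>)) \<in> borel_measurable M"
    "(\<lambda>\<omega>. hess (c2_fun (Q \<omega>)) (X \<omega>)) \<in> borel_measurable M" by auto
qed

lemma borel_measurable_the_default:
  "d \<in> borel_measurable M \<Longrightarrow> (\<lambda>\<omega>. case_option c (\<lambda>x. x) (d \<omega>)) \<in> borel_measurable M"
  by (rule measurable_compose[OF _ borel_measurable_case_option])

lemma borel_measurable_if_Some:
  assumes [measurable]: "Measurable.pred M P" "f \<in> borel_measurable M"
  shows "(\<lambda>\<omega>. if P \<omega> then Some (f \<omega>) else None) \<in> borel_measurable M"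
  by measurable

lemma pred_pos_def [measurable]:
  assumes [measurable]: "A \<in> borel_measurable M"
  shows "Measurable.pred M (\<lambda>\<omega>. pos_def (A \<omega>))"
proof -
  have "A -` {A. pos_def A} \<inter> space M \<in> sets M" by measurable
  also have "A -` {A. pos_def A} \<inter> space M = {\<omega> \<in> space M. pos_def (A \<omega>)}" by auto
  finally show ?thesis by (simp add: pred_def)
qed

lemma borel_measurable_newton_step:
  fixes Q :: "'a \<Rightarrow> 'p::finite c2"
  assumes [measurable]: "Q \<in> borel_measurable M" "d \<in> borel_measurable M"
  shows "(\<lambda>\<omega>. newton_step (Q \<omega>) (d \<omega>)) \<in> borel_measurable M"
proof -
  define x where "x \<omega> = case_option 0 (\<lambda>x. x) (d \<omega>)" for \<omega>
  have [measurable]: "x \<in> borel_measurable M"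
    unfolding x_def by (rule borel_measurable_the_default) simp
  let ?H = "\<lambda>\<omega>. - hess (c2_fun (Q \<omega>)) (x \<omega>)"
  have eq: "newton_step (Q \<omega>) (d \<omega>) = (if d \<omega> \<noteq> None \<and> pos_def (?H \<omega>)
      then Some (x \<omega> + matrix_inv (?H \<omega>) *v grad (c2_fun (Q \<omega>)) (x \<omega>)) else None)" for \<omega>
    by (cases "d \<omega>") (auto simp: newton_step_def x_def)
  show ?thesis unfolding eq by (rule borel_measurable_if_Some) measurable
qed

text \<open>NaO is absorbing, so a sequence that meets it converges to it; otherwise convergence to NaO is
  impossible and the limit is taken in the vector space. This form is visibly measurable.\<close>

lemma newton_inf_eq:
  fixes q :: "'p::finite c2"
  defines "x \<equiv> \<lambda>d m. case_option 0 (\<lambda>x. x) (newton_seq q d m)"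
  shows "newton_inf q d = (if (\<forall>m. newton_seq q d m \<noteq> None) \<and> Cauchy (x d) then Some (lim (x d)) else None)"
proof (cases "\<forall>m. newton_seq q d m \<noteq> None")
  case True
  then have seq: "newton_seq q d m = Some (x d m)" for m
    by (auto simp: x_def split: option.split)
  show ?thesis
  proof (cases "convergent (x d)")
    case conv: True
    then have nlim: "newton_seq q d \<longlonglongrightarrow> Some (lim (x d))"
      unfolding tendsto_Some_iff by (simp add: seq convergent_LIMSEQ_iff)
    then have "newton_inf q d = Some (lim (x d))"
      using limI[OF nlim] convergentI[OF nlim] by (simp add: newton_inf_def)
    then show ?thesis using True conv by (simp add: Cauchy_convergent_iff)
  next
    case False
    have "newton_inf q d = None"
    proof (rule ccontr)
      assume *: "newton_inf q d \<noteq> None"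
      then have "convergent (newton_seq q d)" by (auto simp: newton_inf_def split: if_splits)
      with * obtain y where "newton_seq q d \<longlonglongrightarrow> Some y"
        by (auto simp: newton_inf_def convergent_LIMSEQ_iff)
      then have "x d \<longlonglongrightarrow> y" by (simp add: tendsto_Some_iff seq)
      with False show False by (auto simp: convergent_def)
    qed
    then show ?thesis using False by (simp add: Cauchy_convergent_iff)
  qed
next
  case False
  then obtain m where m: "newton_seq q d m = None" by blast
  have none: "newton_seq q d (k + m) = None" for k
    using m by (induction k) (auto simp: newton_seq_def newton_step_def)
  have nlim: "newton_seq q d \<longlonglongrightarrow> None"
    by (rule LIMSEQ_offset[where k = m]) (simp add: none)
  then have "newton_inf q d = None"
    using limI[OF nlim] by (simp add: newton_inf_def)
  then show ?thesis using False by auto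
qed

lemma borel_measurable_newton_inf:
  fixes Q :: "'a \<Rightarrow> 'p::finite c2"
  assumes Q[measurable]: "Q \<in> borel_measurable M" and d[measurable]: "d \<in> borel_measurable M"
  shows "(\<lambda>\<omega>. newton_inf (Q \<omega>) (d \<omega>)) \<in> borel_measurable M"
proof -
  have [measurable]: "(\<lambda>\<omega>. newton_seq (Q \<omega>) (d \<omega>) m) \<in> borel_measurable M" for m
    unfolding newton_seq_def by (induction m) (simp_all add: d borel_measurable_newton_step Q)
  have [measurable]: "(\<lambda>\<omega>. case_option 0 (\<lambda>x. x) (newton_seq (Q \<omega>) (d \<omega>) m)) \<in> borel_measurable M" for m
    by (rule borel_measurable_the_default) simp
  show ?thesis
    unfolding newton_inf_eq
    by (rule borel_measurable_if_Some) (simp_all add: pred_def sets_Collect_Cauchy del: not_None_eq)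
qed

lemma borel_measurable_neg_hess_nao:
  fixes Q :: "'a \<Rightarrow> 'p::finite c2"
  assumes [measurable]: "Q \<in> borel_measurable M" "d \<in> borel_measurable M"
  shows "(\<lambda>\<omega>. neg_hess_nao (Q \<omega>) (d \<omega>)) \<in> borel_measurable M"
proof -
  have [measurable]: "(\<lambda>\<omega>. case_option 0 (\<lambda>x. x) (d \<omega>)) \<in> borel_measurable M"
    by (rule borel_measurable_the_default) simp
  have eq: "neg_hess_nao (Q \<omega>) (d \<omega>) = (if d \<omega> \<noteq> None
      then Some (- hess (c2_fun (Q \<omega>)) (case_option 0 (\<lambda>x. x) (d \<omega>))) else None)" for \<omega>
    by (cases "d \<omega>") (auto simp: neg_hess_nao_def)
  show ?thesis unfolding eq by (rule borel_measurable_if_Some) measurable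
qed

lemma borel_measurable_sqrt_mult_nao:
  fixes A :: "'a \<Rightarrow> (real^'p^'p) option"
  assumes [measurable]: "A \<in> borel_measurable M" "d \<in> borel_measurable M"
  shows "(\<lambda>\<omega>. mult_nao (sqrt_nao (A \<omega>)) (d \<omega>)) \<in> borel_measurable M"
proof -
  define x where "x \<omega> = case_option 0 (\<lambda>x. x) (d \<omega>)" for \<omega>
  define S where "S \<omega> = case_option 0 (\<lambda>x. x) (A \<omega>)" for \<omega>
  have [measurable]: "x \<in> borel_measurable M" "S \<in> borel_measurable M"
    unfolding x_def S_def by (auto intro!: borel_measurable_the_default)
  have [measurable]: "(\<lambda>\<omega>. if pos_def (S \<omega>) then sym_sqrt (S \<omega>) else 0) \<in> borel_measurable M"
    by (rule measurable_compose[OF _ borel_measurable_sym_sqrt]) simp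
  have eq: "mult_nao (sqrt_nao (A \<omega>)) (d \<omega>) = (if A \<omega> \<noteq> None \<and> d \<omega> \<noteq> None \<and> pos_def (S \<omega>)
      then Some ((if pos_def (S \<omega>) then sym_sqrt (S \<omega>) else 0) *v x \<omega>) else None)" for \<omega>
    by (cases "d \<omega>"; cases "A \<omega>") (auto simp: mult_nao_def sqrt_nao_def x_def S_def)
  show ?thesis unfolding eq by (rule borel_measurable_if_Some) measurable
qed


section \<open>The law of the standardised score\<close>

lemma sym_sqrt_sandwich:
  fixes K :: "real^'n^'n"
  assumes "pos_def K"
  shows "sym_sqrt K *v (matrix_inv K *v (sym_sqrt K *v x)) = x"
proof -
  have "sym_sqrt K ** (sym_sqrt K ** matrix_inv K) = mat 1"
    using sym_sqrt(2)[OF pos_def_imp_semidef[OF assms]] invertible_matrix_inv(1)[OF pos_def_invertible[OF assms]]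
    by (simp add: matrix_mul_assoc)
  then have "(sym_sqrt K ** matrix_inv K) ** sym_sqrt K = mat 1"
    by (simp add: matrix_left_right_inverse)
  then have "((sym_sqrt K ** matrix_inv K) ** sym_sqrt K) *v x = x" by simp
  then show ?thesis by (simp only: matrix_vector_mul_assoc[symmetric])
qed

lemma sets_std_mvn [simp, measurable_cong]: "sets std_mvn = sets borel" and space_std_mvn [simp]: "space std_mvn = UNIV"
  by (simp_all add: std_mvn_def)

lemma mvn_standard: "mvn 0 (mat 1) = (std_mvn :: (real^'p) measure)"
  by (simp add: mvn_def sym_sqrt_mat_1 distr_id2)

lemma emeasure_mvn_0:
  assumes "B \<in> sets borel"
  shows "emeasure (mvn 0 k) B = emeasure std_mvn {x. sym_sqrt k *v x \<in> B}"
  using assms by (simp add: mvn_def emeasure_distr vimage_def)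

lemma emeasure_distr_pair_measure:
  assumes G: "sigma_finite_measure G" "space G = UNIV"
    and f: "f \<in> Q \<Otimes>\<^sub>M G \<rightarrow>\<^sub>M L" and B: "B \<in> sets L"
  shows "emeasure (distr (Q \<Otimes>\<^sub>M G) L f) B = (\<integral>\<^sup>+k. emeasure G {x. f (k, x) \<in> B} \<partial>Q)"
    and "(\<lambda>k. emeasure G {x. f (k, x) \<in> B}) \<in> borel_measurable Q"
proof -
  interpret G: sigma_finite_measure G by fact
  have V: "f -` B \<inter> space (Q \<Otimes>\<^sub>M G) \<in> sets (Q \<Otimes>\<^sub>M G)"
    by (rule measurable_sets[OF f B])
  have eq: "Pair k -` (f -` B \<inter> space (Q \<Otimes>\<^sub>M G)) = {x. f (k, x) \<in> B}" if "k \<in> space Q" for k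
    using that G(2) by (auto simp: space_pair_measure)
  show "emeasure (distr (Q \<Otimes>\<^sub>M G) L f) B = (\<integral>\<^sup>+k. emeasure G {x. f (k, x) \<in> B} \<partial>Q)"
    unfolding emeasure_distr[OF f B] G.emeasure_pair_measure_alt[OF V]
    by (intro nn_integral_cong) (simp only: eq)
  show "(\<lambda>k. emeasure G {x. f (k, x) \<in> B}) \<in> borel_measurable Q"
    using G.measurable_emeasure_Pair[OF V] by (rule measurable_cong[THEN iffD1, rotated]) (simp only: eq)
qed

text \<open>The joint law of \<open>(K, Z)\<close> is that of \<open>(K, K\<^sup>1\<^sup>/\<^sup>2\<xi>)\<close> with \<open>\<xi>\<close> standard normal and independent of \<open>K\<close>: both assign
  to a rectangle \<open>A \<times> B\<close> the integral over \<open>K \<in> A\<close> of the conditional probability of \<open>B\<close>. The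
  function \<open>S\<close> is a measurable version of the square root. That the standard normal law has total mass one
  comes from the kernel at the identity matrix.\<close>

lemma distr_pair_conditional_normal:
  fixes Z :: "'a \<Rightarrow> real^'p" and K :: "'a \<Rightarrow> real^'p^'p"
  assumes P: "prob_space P" and cond: "has_cond_distr P Z K (mvn 0)"
    and pd: "AE \<omega> in P. pos_def (K \<omega>)"
    and S[measurable]: "S \<in> borel_measurable borel" and S_eq: "\<And>k. pos_def k \<Longrightarrow> S k = sym_sqrt k"
  shows "distr P (borel \<Otimes>\<^sub>M borel) (\<lambda>\<omega>. (K \<omega>, Z \<omega>)) =
    distr (distr P borel K \<Otimes>\<^sub>M std_mvn) (borel \<Otimes>\<^sub>M borel) (\<lambda>(k, x). (k, S k *v x))" (is "?L = ?R")
    and "prob_space (std_mvn :: (real^'p) measure)"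
proof -
  interpret P: prob_space P by fact
  have Z[measurable]: "Z \<in> borel_measurable P" and K[measurable]: "K \<in> borel_measurable P"
    and kern: "mvn 0 \<in> borel \<rightarrow>\<^sub>M prob_algebra (borel :: (real^'p) measure)"
    and ce: "\<And>B. B \<in> sets borel \<Longrightarrow> AE x in P.
        real_cond_exp P (vimage_algebra (space P) K borel) (\<lambda>x. indicator B (Z x)) x = measure (mvn 0 (K x)) B"
    using cond by (auto simp: has_cond_distr_def)
  have prob: "prob_space (mvn 0 k :: (real^'p) measure)" for k
    using measurable_space[OF kern, of k] by (simp add: space_prob_algebra)
  show std: "prob_space (std_mvn :: (real^'p) measure)"
    using prob[of "mat 1"] by (simp add: mvn_standard)
  interpret \<gamma>: prob_space "std_mvn :: (real^'p) measure" by fact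
  interpret Q: prob_space "distr P borel K" by (rule P.prob_space_distr) simp
  interpret PQ: pair_prob_space "distr P borel K" "std_mvn :: (real^'p) measure" ..
  have meas_mvn[measurable]: "(\<lambda>k. measure (mvn 0 k) B) \<in> borel_measurable borel"
    if "B \<in> sets borel" for B :: "(real^'p) set"
    by (rule measurable_compose[OF kern measurable_measure_prob_algebra[OF that]])
  let ?F = "vimage_algebra (space P) K borel"
  have sub: "subalgebra P ?F"
    using measurable_sets[OF K] by (auto simp: subalgebra_def sets_vimage_algebra2)
  interpret F: finite_measure_subalgebra P ?F
    by unfold_locales (rule sub)
  let ?E = "{a \<times> b | a b. a \<in> sets (borel :: (real^'p^'p) measure) \<and> b \<in> sets (borel :: (real^'p) measure)}"
  show "?L = ?R"
  proof (rule measure_eqI_generator_eq[OF Int_stable_pair_measure_generator, where A = "\<lambda>_. UNIV"])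
    show "?E \<subseteq> Pow UNIV" by auto
    show "sets ?L = sigma_sets UNIV ?E" "sets ?R = sigma_sets UNIV ?E"
      by (simp_all add: sets_pair_measure)
    have "UNIV \<times> UNIV \<in> ?E"
      by (rule CollectI, rule exI[of _ UNIV], rule exI[of _ UNIV]) simp
    then show "range (\<lambda>_::nat. UNIV) \<subseteq> ?E" by (simp add: UNIV_Times_UNIV)
    interpret L: prob_space ?L by (rule P.prob_space_distr) measurable
    show "emeasure ?L UNIV \<noteq> \<infinity>"
      using L.emeasure_finite by simp
    fix X assume "X \<in> ?E"
    then have "\<exists>A B. X = A \<times> B \<and> A \<in> sets borel \<and> B \<in> sets borel" by (rule CollectD)
    then obtain A B where X: "X = A \<times> B" and A[measurable]: "A \<in> sets borel" and B[measurable]: "B \<in> sets borel" by auto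
    have f: "(\<lambda>(k, x). (k, S k *v x)) \<in> distr P borel K \<Otimes>\<^sub>M std_mvn \<rightarrow>\<^sub>M borel \<Otimes>\<^sub>M borel" by measurable
    have "X \<in> sets (borel \<Otimes>\<^sub>M borel)" unfolding X using A B by (rule pair_measureI)
    note R = emeasure_distr_pair_measure[OF \<gamma>.sigma_finite_measure_axioms space_std_mvn f this, unfolded prod.case]
    have A': "K -` A \<inter> space P \<in> sets ?F" by (rule in_vimage_algebra[OF A])
    have "emeasure ?L X = emeasure P ((K -` A \<inter> space P) \<inter> (Z -` B \<inter> space P))"
      unfolding X by (subst emeasure_distr) (auto intro!: arg_cong[where f = "emeasure P"])
    also have "\<dots> = ennreal (\<integral>\<omega>. indicator ((K -` A \<inter> space P) \<inter> (Z -` B \<inter> space P)) \<omega> \<partial>P)"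
      by (simp add: P.emeasure_eq_measure)
    also have "(\<integral>\<omega>. indicator ((K -` A \<inter> space P) \<inter> (Z -` B \<inter> space P)) \<omega> \<partial>P) =
        (\<integral>\<omega>\<in>(K -` A \<inter> space P). indicator B (Z \<omega>) \<partial>P)"
      unfolding set_lebesgue_integral_def by (intro Bochner_Integration.integral_cong) (auto simp: indicator_def)
    also have "\<dots> = (\<integral>\<omega>\<in>(K -` A \<inter> space P). real_cond_exp P ?F (\<lambda>x. indicator B (Z x)) \<omega> \<partial>P)"
      by (rule F.real_cond_exp_intA[OF _ A'], rule P.integrable_const_bound[where B = 1]) (auto simp: indicator_def)
    also have "\<dots> = (\<integral>\<omega>. indicator A (K \<omega>) * measure (mvn 0 (K \<omega>)) B \<partial>P)"
      unfolding set_lebesgue_integral_def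
    proof (rule integral_cong_AE)
      show "AE \<omega> in P. indicat_real (K -` A \<inter> space P) \<omega> *\<^sub>R real_cond_exp P ?F (\<lambda>x. indicator B (Z x)) \<omega>
          = indicator A (K \<omega>) * measure (mvn 0 (K \<omega>)) B"
        using ce[OF B] AE_space by eventually_elim (auto simp: indicator_def)
    qed measurable
    also have "ennreal \<dots> = (\<integral>\<^sup>+\<omega>. ennreal (indicator A (K \<omega>) * measure (mvn 0 (K \<omega>)) B) \<partial>P)"
    proof (rule nn_integral_eq_integral[symmetric])
      have "measure (mvn 0 k) B \<le> 1" for k
        using prob_space.prob_le_1[OF prob] by blast
      then show "integrable P (\<lambda>\<omega>. indicator A (K \<omega>) * measure (mvn 0 (K \<omega>)) B)"
        by (intro P.integrable_const_bound[where B = 1]) (auto simp: indicator_def)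
    qed auto
    also have "\<dots> = (\<integral>\<^sup>+\<omega>. emeasure std_mvn {x. K \<omega> \<in> A \<and> S (K \<omega>) *v x \<in> B} \<partial>P)"
    proof (rule nn_integral_cong_AE)
      show "AE \<omega> in P. ennreal (indicator A (K \<omega>) * measure (mvn 0 (K \<omega>)) B) =
          emeasure std_mvn {x. K \<omega> \<in> A \<and> S (K \<omega>) *v x \<in> B}"
        using pd
      proof eventually_elim
        case (elim \<omega>)
        then show ?case
          using emeasure_mvn_0[OF B, of "K \<omega>"]
          by (cases "K \<omega> \<in> A")
            (simp_all add: S_eq finite_measure.emeasure_eq_measure[OF prob_space.finite_measure[OF prob]])
      qed
    qed
    also have "\<dots> = (\<integral>\<^sup>+k. emeasure std_mvn {x. k \<in> A \<and> S k *v x \<in> B} \<partial>distr P borel K)"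
      using R(2) by (intro nn_integral_distr[symmetric]) (simp_all add: X)
    also have "\<dots> = emeasure ?R X"
      using R(1) by (simp add: X)
    finally show "emeasure ?L X = emeasure ?R X" .
  qed simp
qed

text \<open>Under the representation by \<open>\<xi>\<close> the variable equals \<open>K\<^sup>1\<^sup>/\<^sup>2K\<^sup>-\<^sup>1K\<^sup>1\<^sup>/\<^sup>2\<xi> = \<xi>\<close>.\<close>

lemma distr_standardised:
  fixes Z :: "'a \<Rightarrow> real^'p" and K :: "'a \<Rightarrow> real^'p^'p"
  assumes P: "prob_space P" and cond: "has_cond_distr P Z K (mvn 0)"
    and pd: "AE \<omega> in P. pos_def (K \<omega>)"
    and S[measurable]: "S \<in> borel_measurable borel" and S_eq: "\<And>k. pos_def k \<Longrightarrow> S k = sym_sqrt k"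
  shows "distr P borel (\<lambda>\<omega>. S (K \<omega>) *v (matrix_inv (K \<omega>) *v Z \<omega>)) = mvn 0 (mat 1)"
proof -
  interpret P: prob_space P by fact
  interpret \<gamma>: prob_space "std_mvn :: (real^'p) measure"
    by (rule distr_pair_conditional_normal(2)[OF P cond pd S S_eq])
  have Z[measurable]: "Z \<in> borel_measurable P" and K[measurable]: "K \<in> borel_measurable P"
    using cond by (auto simp: has_cond_distr_def)
  interpret Q: prob_space "distr P borel K" by (rule P.prob_space_distr) simp
  interpret PQ: pair_prob_space "distr P borel K" "std_mvn :: (real^'p) measure" ..
  have pair: "distr P (borel \<Otimes>\<^sub>M borel) (\<lambda>\<omega>. (K \<omega>, Z \<omega>)) =
    distr (distr P borel K \<Otimes>\<^sub>M std_mvn) (borel \<Otimes>\<^sub>M borel) (\<lambda>(k, x). (k, S k *v x))"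
    by (rule distr_pair_conditional_normal(1)[OF P cond pd S S_eq])
  define g where "g = (\<lambda>(k, z). S k *v (matrix_inv k *v z))"
  have g[measurable]: "g \<in> borel_measurable (borel \<Otimes>\<^sub>M borel)"
    unfolding g_def by measurable
  have "distr P borel (\<lambda>\<omega>. S (K \<omega>) *v (matrix_inv (K \<omega>) *v Z \<omega>)) =
      distr (distr P (borel \<Otimes>\<^sub>M borel) (\<lambda>\<omega>. (K \<omega>, Z \<omega>))) borel g"
    by (subst distr_distr) (auto simp: g_def o_def)
  also have "\<dots> = distr (distr P borel K \<Otimes>\<^sub>M std_mvn) borel (\<lambda>(k, x). g (k, S k *v x))"
    unfolding pair by (subst distr_distr) (auto simp: o_def split_beta')
  also have "\<dots> = std_mvn"
  proof (rule measure_eqI)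
    fix B assume "B \<in> sets (distr (distr P borel K \<Otimes>\<^sub>M std_mvn) borel (\<lambda>(k, x). g (k, S k *v x)))"
    then have B[measurable]: "B \<in> sets borel" by simp
    have "AE k in distr P borel K. pos_def k"
      using pd by (subst AE_distr_iff) auto
    then have "AE k in distr P borel K. emeasure std_mvn {x. g (k, S k *v x) \<in> B} = emeasure std_mvn B"
      by eventually_elim (simp add: g_def S_eq sym_sqrt_sandwich)
    then have "(\<integral>\<^sup>+k. emeasure std_mvn {x. g (k, S k *v x) \<in> B} \<partial>distr P borel K) = (\<integral>\<^sup>+k. emeasure std_mvn B \<partial>distr P borel K)"
      by (rule nn_integral_cong_AE)
    also have "\<dots> = emeasure std_mvn B"
      using Q.emeasure_space_1 by simp
    finally have "(\<integral>\<^sup>+k. emeasure std_mvn {x. g (k, S k *v x) \<in> B} \<partial>distr P borel K) = emeasure std_mvn B" .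
    moreover have "(\<integral>\<^sup>+k. emeasure std_mvn {x. g (k, S k *v x) \<in> B} \<partial>distr P borel K) =
        emeasure (distr (distr P borel K \<Otimes>\<^sub>M std_mvn) borel (\<lambda>(k, x). g (k, S k *v x))) B"
      by (subst emeasure_distr_pair_measure(1)[OF \<gamma>.sigma_finite_measure_axioms space_std_mvn _ B]) auto
    ultimately show "emeasure (distr (distr P borel K \<Otimes>\<^sub>M std_mvn) borel (\<lambda>(k, x). g (k, S k *v x))) B = emeasure std_mvn B" by simp
  qed simp
  finally show ?thesis by (simp add: mvn_standard)
qed


section \<open>Convergence of the Newton estimator\<close>

lemma quad_loglik_derivatives:
  fixes K :: "real^'p^'p"
  assumes K: "transpose K = K"
  shows "grad (quad_loglik z K) x = z - K *v x" and "hess (quad_loglik z K) x = - K"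
proof -
  have K': "((\<lambda>x. K *v x) has_derivative (\<lambda>h. K *v h)) (at x)" for x
    by (rule bounded_linear_imp_has_derivative[OF matrix_vector_mul_bounded_linear])
  have D: "(quad_loglik z K has_derivative (\<lambda>h. (z - K *v x) \<bullet> h)) (at x)" for x
  proof -
    have "((\<lambda>x. x \<bullet> z - 1 / 2 * (x \<bullet> (K *v x))) has_derivative
        (\<lambda>h. h \<bullet> z - 1 / 2 * (x \<bullet> (K *v h) + h \<bullet> (K *v x)))) (at x)"
      by (intro has_derivative_diff has_derivative_mult_right has_derivative_inner
          has_derivative_inner_left has_derivative_ident K')
    moreover have "h \<bullet> z - 1 / 2 * (x \<bullet> (K *v h) + h \<bullet> (K *v x)) = (z - K *v x) \<bullet> h" for h
      using symmetric_inner_mult[OF K, of x h] inner_commute[of h] by (simp add: inner_diff_left)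
    ultimately show ?thesis by (simp add: quad_loglik_def[abs_def])
  qed
  have g: "grad (quad_loglik z K) = (\<lambda>x. z - K *v x)"
    unfolding grad_def frechet_derivative_at[OF D, symmetric]
    by (simp add: vec_eq_iff fun_eq_iff inner_axis)
  then show "grad (quad_loglik z K) x = z - K *v x" by simp
  have "((\<lambda>x. z - K *v x) has_derivative (\<lambda>h. (- K) *v h)) (at x)"
  proof -
    have "((\<lambda>x. z - K *v x) has_derivative (\<lambda>h. 0 - K *v h)) (at x)"
      by (intro has_derivative_diff has_derivative_const K')
    moreover have "0 - K *v h = (- K) *v h" for h
      using matrix_vector_mult_diff_rdistrib[of 0 K h] by simp
    ultimately show ?thesis by simp
  qed
  from frechet_derivative_at[OF this, symmetric] show "hess (quad_loglik z K) x = - K"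
    by (simp only: hess_def jacobian_def g matrix_of_matrix_vector_mul)
qed

theorem theoremB3:
  fixes M :: "nat \<Rightarrow> 'w measure" and N :: "'v measure"
    and q :: "nat \<Rightarrow> 'w \<Rightarrow> ('p::finite) c2" and \<delta>t :: "nat \<Rightarrow> 'w \<Rightarrow> real^'p"
    and X :: "nat \<Rightarrow> 'w \<Rightarrow> 'x" and \<mu> :: "nat \<Rightarrow> 'x measure"
    and f :: "nat \<Rightarrow> real^'p \<Rightarrow> 'x \<Rightarrow> real"
    and qL :: "'v \<Rightarrow> 'p c2" and \<delta>tL :: "'v \<Rightarrow> real^'p"
    and XL :: "'v \<Rightarrow> 'y" and \<mu>L :: "'y measure"
    and fL :: "real^'p \<Rightarrow> 'y \<Rightarrow> real"
    and Z0 :: "'y \<Rightarrow> real^'p" and K0 :: "'y \<Rightarrow> real^'p^'p"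
    and Z :: "'v \<Rightarrow> real^'p" and K :: "'v \<Rightarrow> real^'p^'p"
    and \<delta>h :: "nat \<Rightarrow> 'w \<Rightarrow> (real^'p) option"
  assumes "\<And>n. prob_space (M n)" and "prob_space N"
    and "\<And>n. log_likelihood (M n) (X n) (\<mu> n) (f n) (q n)"
    and "LAMN_model \<mu>L fL Z0 K0"
    and "log_likelihood N XL \<mu>L fL qL"
    and "\<And>\<omega>. Z \<omega> = Z0 (XL \<omega>)" and "\<And>\<omega>. K \<omega> = K0 (XL \<omega>)"
    and "AE \<omega> in N. \<forall>\<delta>. c2_fun (qL \<omega>) \<delta> = quad_loglik (Z \<omega>) (K \<omega>) \<delta>"
    and "AE \<omega> in N. pos_def (K \<omega>)"
    and "conv_in_law M (\<lambda>n \<omega>. (q n \<omega>, \<delta>t n \<omega>)) N (\<lambda>\<omega>. (qL \<omega>, \<delta>tL \<omega>))"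
    and "\<And>n \<omega>. \<delta>h n \<omega> = newton_inf (q n \<omega>) (Some (\<delta>t n \<omega>))"
  shows "conv_in_law M (\<lambda>n \<omega>. - hess (c2_fun (q n \<omega>)) (\<delta>t n \<omega>)) N K \<and>
         conv_in_law M (\<lambda>n \<omega>. neg_hess_nao (q n \<omega>) (\<delta>h n \<omega>)) N (\<lambda>\<omega>. Some (K \<omega>)) \<and>
         conv_in_law M \<delta>h N (\<lambda>\<omega>. Some (matrix_inv (K \<omega>) *v Z \<omega>)) \<and>
         conv_in_law M (\<lambda>n \<omega>. mult_nao (sqrt_nao (neg_hess_nao (q n \<omega>) (\<delta>h n \<omega>))) (\<delta>h n \<omega>))
           (mvn 0 (mat 1)) Some \<and>
         (\<exists>W :: 'v \<Rightarrow> real^'p. W \<in> borel_measurable N \<and> distr N borel W = mvn 0 (mat 1) \<and>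
           conv_in_law M
             (\<lambda>n \<omega>. (q n \<omega>, \<delta>t n \<omega>,
                      - hess (c2_fun (q n \<omega>)) (\<delta>t n \<omega>),
                      neg_hess_nao (q n \<omega>) (\<delta>h n \<omega>),
                      \<delta>h n \<omega>,
                      mult_nao (sqrt_nao (neg_hess_nao (q n \<omega>) (\<delta>h n \<omega>))) (\<delta>h n \<omega>)))
             N
             (\<lambda>\<omega>. (qL \<omega>, \<delta>tL \<omega>, K \<omega>, Some (K \<omega>),
                     Some (matrix_inv (K \<omega>) *v Z \<omega>), Some (W \<omega>))))"
proof -
  note N = assms(2) and lamn = assms(4) and llL = assms(5) and Z = assms(6) and K = assms(7)
    and conv = assms(10) and \<delta>h = assms(11)
  interpret N: prob_space N by fact
  let ?P = "model_law \<mu>L fL 0"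
  have q [measurable]: "q n \<in> borel_measurable (M n)" for n
    using assms(3)[of n] by (simp add: log_likelihood_def)
  have XL [measurable]: "XL \<in> N \<rightarrow>\<^sub>M \<mu>L" and XL_law: "distr N \<mu>L XL = ?P"
    and qL [measurable]: "qL \<in> borel_measurable N"
    using llL by (auto simp: log_likelihood_def)
  have [measurable]: "Z0 \<in> borel_measurable \<mu>L" "K0 \<in> borel_measurable \<mu>L"
    and P: "prob_space ?P" and cond: "has_cond_distr ?P Z0 K0 (mvn 0)"
    using lamn[unfolded LAMN_model_def parametric_model_def] by (auto dest!: spec[of _ 0])
  have [measurable]: "Z \<in> borel_measurable N" "K \<in> borel_measurable N"
    unfolding Z[abs_def] K[abs_def] by measurable
  have pair: "(\<lambda>\<omega>. (q n \<omega>, \<delta>t n \<omega>)) \<in> borel_measurable (M n)" "(\<lambda>\<omega>. (qL \<omega>, \<delta>tL \<omega>)) \<in> borel_measurable N" for n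
    using conv by (auto simp: conv_in_law_def)
  have snd: "snd \<in> borel_measurable (borel :: ('p c2 \<times> (real^'p)) measure)"
    by (intro borel_measurable_continuous_onI continuous_on_snd continuous_on_id)
  have \<delta>t [measurable]: "\<delta>t n \<in> borel_measurable (M n)" for n
    using measurable_compose[OF pair(1) snd] by simp
  have \<delta>tL [measurable]: "\<delta>tL \<in> borel_measurable N"
    using measurable_compose[OF pair(2) snd] by simp

  \<comment> \<open>the square root is modified off the positive definite matrices to make \<open>W\<close> measurable\<close>
  define S :: "real^'p^'p \<Rightarrow> real^'p^'p" where "S k = (if pos_def k then sym_sqrt k else 0)" for k
  have S [measurable]: "S \<in> borel_measurable borel"
    unfolding S_def by (rule borel_measurable_sym_sqrt)
  have S_eq: "S k = sym_sqrt k" if "pos_def k" for k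
    using that by (simp add: S_def)
  define W where "W \<omega> = S (K \<omega>) *v (matrix_inv (K \<omega>) *v Z \<omega>)" for \<omega>
  have W [measurable]: "W \<in> borel_measurable N"
    unfolding W_def by measurable
  have W_law: "distr N borel W = mvn 0 (mat 1)"
  proof -
    have "AE x in ?P. pos_def (K0 x)"
      unfolding XL_law[symmetric] using assms(9) by (subst AE_distr_iff) (auto simp: K)
    from distr_standardised[OF P cond this S S_eq]
    have "distr ?P borel (\<lambda>x. S (K0 x) *v (matrix_inv (K0 x) *v Z0 x)) = mvn 0 (mat 1)" by simp
    then show ?thesis
      unfolding XL_law[symmetric] by (subst (asm) distr_distr) (auto simp: W_def[abs_def] Z K o_def)
  qed

  define G where "G p = (let q = fst p; d = snd p; n = newton_inf q (Some d); H = neg_hess_nao q n in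
      (q, d, - hess (c2_fun q) d, H, n, mult_nao (sqrt_nao H) n))" for p :: "'p c2 \<times> (real^'p)"
  have joint: "conv_in_law M (\<lambda>n \<omega>. G (q n \<omega>, \<delta>t n \<omega>)) N
      (\<lambda>\<omega>. (qL \<omega>, \<delta>tL \<omega>, K \<omega>, Some (K \<omega>), Some (matrix_inv (K \<omega>) *v Z \<omega>), Some (W \<omega>)))"
  proof (rule c2_vec.continuous_mapping[OF assms(1) N conv])
    show "(\<lambda>\<omega>. G (q n \<omega>, \<delta>t n \<omega>)) \<in> borel_measurable (M n)" for n
      unfolding G_def Let_def fst_conv snd_conv
      by (intro borel_measurable_Pair_second_countable borel_measurable_sqrt_mult_nao
          borel_measurable_neg_hess_nao borel_measurable_newton_inf) measurable
    show "(\<lambda>\<omega>. (qL \<omega>, \<delta>tL \<omega>, K \<omega>, Some (K \<omega>), Some (matrix_inv (K \<omega>) *v Z \<omega>), Some (W \<omega>))) \<in> borel_measurable N"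
      by (intro borel_measurable_Pair_second_countable) measurable
    have lim: "(G \<longlongrightarrow> (qL \<omega>, \<delta>tL \<omega>, K \<omega>, Some (K \<omega>), Some (matrix_inv (K \<omega>) *v Z \<omega>), Some (W \<omega>)))
        (nhds (qL \<omega>, \<delta>tL \<omega>))"
      if quad: "\<forall>\<delta>. c2_fun (qL \<omega>) \<delta> = quad_loglik (Z \<omega>) (K \<omega>) \<delta>" and pd: "pos_def (K \<omega>)" for \<omega>
    proof -
      have "c2_fun (qL \<omega>) = quad_loglik (Z \<omega>) (K \<omega>)" using quad by auto
      then have d: "\<And>x. grad (c2_fun (qL \<omega>)) x = Z \<omega> - K \<omega> *v x" "\<And>x. hess (c2_fun (qL \<omega>)) x = - K \<omega>"
        using quad_loglik_derivatives[of "K \<omega>"] pd by (auto simp: pos_def_def)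
      have f: "(fst \<longlongrightarrow> qL \<omega>) (nhds (qL \<omega>, \<delta>tL \<omega>))" and s: "(snd \<longlongrightarrow> \<delta>tL \<omega>) (nhds (qL \<omega>, \<delta>tL \<omega>))"
        using tendsto_fst[OF filterlim_ident] tendsto_snd[OF filterlim_ident] by fastforce+
      have h: "((\<lambda>p. - hess (c2_fun (fst p)) (snd p)) \<longlongrightarrow> K \<omega>) (nhds (qL \<omega>, \<delta>tL \<omega>))"
        using tendsto_minus[OF tendsto_c2_eval(2)[OF f s]] by (simp add: d)
      show ?thesis
        unfolding G_def[abs_def] Let_def W_def S_eq[OF pd]
        by (intro tendsto_Pair f s h newton_inf_tendsto[OF pd d f s] newton_outputs_tendsto[OF pd d f s])
    qed
    show "AE \<omega> in N. (G \<longlongrightarrow> (qL \<omega>, \<delta>tL \<omega>, K \<omega>, Some (K \<omega>), Some (matrix_inv (K \<omega>) *v Z \<omega>), Some (W \<omega>)))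
        (nhds (qL \<omega>, \<delta>tL \<omega>))"
      using assms(8,9) by eventually_elim (rule lim)
  qed
  note joint = joint[unfolded G_def Let_def fst_conv snd_conv, folded \<delta>h]
  have proj: "continuous_on UNIV (\<lambda>p. fst (snd (snd p)))" "continuous_on UNIV (\<lambda>p. fst (snd (snd (snd p))))"
    "continuous_on UNIV (\<lambda>p. fst (snd (snd (snd (snd p)))))" "continuous_on UNIV (\<lambda>p. snd (snd (snd (snd (snd p)))))"
    by (intro continuous_intros)+
  have "conv_in_law M (\<lambda>n \<omega>. mult_nao (sqrt_nao (neg_hess_nao (q n \<omega>) (\<delta>h n \<omega>))) (\<delta>h n \<omega>)) N (\<lambda>\<omega>. Some (W \<omega>))"
    using conv_in_law_continuous_image[OF joint proj(4)] by simp
  from conv_in_law_distr[OF this W borel_measurable_Some]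
  show ?thesis
    using conv_in_law_continuous_image[OF joint proj(1)] conv_in_law_continuous_image[OF joint proj(2)]
      conv_in_law_continuous_image[OF joint proj(3)] joint W W_law
    by (auto intro!: exI[of _ W])
qed

end
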